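(* Let $\alpha>0$, let $W(t,\omega)$, $t>0$, $\omega\in\Omega$, be a Wiener process, let $w(t)=\frac{1}{t(1-t)}$ on $(0,1)$, and let $\tilde g\in L^2_w(0,1)$. Let $$\tilde b_n=\int_0^1\tilde\psi_n^{\alpha}(t)\,\tilde g(t)\,w(t)\,dt,\qquad \tilde B_n(\omega)=\int_0^1\tilde\psi_n^{\alpha}(s)\sqrt{w(s)}\,dW(s,\omega),\qquad n\in\mathbb{N}_0,$$ where $\tilde\psi_n^{\alpha}$ are the transformed Hermite functions. Then for every $t\in(0,1)$ the random series $$\sum_{n=0}^{\infty}\tilde b_n\tilde B_n(\omega)\tilde\psi_n^{\alpha}(t)$$ converges in quadratic mean (i.e. in $L^2(\Omega)$) to the stochastic integral $\int_0^1\tilde g(s,t)\sqrt{w(s)}\,dW(s,\omega)$, where $\tilde g(s,t)=\sum_{k=0}^{\infty}\tilde b_k\tilde\psi_k^{\alpha}(s)\tilde\psi_k^{\alpha}(t)$ (sum of the series in $L^2_w(0,1)$ in the variable $s$).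
   Context: $\mathbb{N}_0=\{0,1,2,\dots\}$. The Hermite polynomials are $H_n(t)=(-1)^n e^{t^2}\frac{d^n}{dt^n}e^{-t^2}$. For $\alpha>0$ the generalized Hermite functions are $\psi_n^{\alpha}(t)=\frac{\sqrt{\alpha}}{\sqrt{2^n n!\sqrt{\pi}}}H_n(\alpha t)e^{-\alpha^2t^2/2}$, $t\in\mathbb{R}$. With $\phi(x)=\ln\frac{x}{1-x}$, $x\in(0,1)$, the transformed Hermite functions are $\tilde\psi_n^{\alpha}(x)=\psi_n^{\alpha}(\phi(x))$, $x\in(0,1)$. The weight is $w(x)=\phi'(x)=\frac{1}{x(1-x)}$, and $L^2_w(0,1)$ is the space of measurable $g$ on $(0,1)$ with $\int_0^1|g(x)|^2w(x)\,dx<\infty$. For $f\in L^2(0,1)$ the stochastic integral $\int_0^1 f(s)\,dW(s,\omega)$ is defined in quadratic mean (the Wiener integral), with $E\left|\int_0^1 f\,dW\right|^2=c^2\int_0^1|f(s)|^2ds$, where $c>0$ is the constant associated with the normal law of the increments of $W$; hence $\int_0^1 f(s)\sqrt{w(s)}\,dW(s,\omega)$ is defined for $f\in L^2_w(0,1)$. *)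

theory Defs
  imports "HOL-Probability.Probability"
begin

section \<open>Convergence in quadratic mean\<close>

text \<open>The space $L^2(N)$ of real functions (not classes modulo null sets).
  With \<open>N\<close> a probability space this gives the random variables of finite variance.\<close>

definition L2 :: "'a measure \<Rightarrow> ('a \<Rightarrow> real) set" where
  "L2 N = {f \<in> borel_measurable N. integrable N (\<lambda>x. \<bar>f x\<bar>\<^sup>2)}"

text \<open>Membership in \<open>L2 N\<close> is required explicitly, because the Bochner integral of a
  non-integrable function is 0.\<close>

definition L2_tendsto :: "'a measure \<Rightarrow> (nat \<Rightarrow> 'a \<Rightarrow> real) \<Rightarrow> ('a \<Rightarrow> real) \<Rightarrow> bool" where
  "L2_tendsto N F f \<longleftrightarrow>
     (\<forall>n. F n \<in> L2 N) \<and> f \<in> L2 N \<and>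
     (\<lambda>n. LINT x|N. \<bar>F n x - f x\<bar>\<^sup>2) \<longlonglongrightarrow> 0"

definition L2_sums :: "'a measure \<Rightarrow> (nat \<Rightarrow> 'a \<Rightarrow> real) \<Rightarrow> ('a \<Rightarrow> real) \<Rightarrow> bool" where
  "L2_sums N u S \<longleftrightarrow> L2_tendsto N (\<lambda>n x. \<Sum>k<n. u k x) S"


section \<open>Transformed Hermite functions\<close>

definition hermite_H :: "nat \<Rightarrow> real \<Rightarrow> real" where
  "hermite_H n t = (-1) ^ n * exp (t\<^sup>2) * (deriv ^^ n) (\<lambda>x. exp (- x\<^sup>2)) t"

definition hermite_fun :: "real \<Rightarrow> nat \<Rightarrow> real \<Rightarrow> real" where
  "hermite_fun \<alpha> n t =
     sqrt \<alpha> / sqrt (2 ^ n * fact n * sqrt pi) * hermite_H n (\<alpha> * t) * exp (- \<alpha>\<^sup>2 * t\<^sup>2 / 2)"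

definition logit :: "real \<Rightarrow> real" where
  "logit x = ln (x / (1 - x))"

definition thermite_fun :: "real \<Rightarrow> nat \<Rightarrow> real \<Rightarrow> real" where
  "thermite_fun \<alpha> n x = hermite_fun \<alpha> n (logit x)"

definition weight :: "real \<Rightarrow> real" where
  "weight x = 1 / (x * (1 - x))"

abbreviation unit_measure :: "real measure" where
  "unit_measure \<equiv> lebesgue_on {0<..<1}"

text \<open>\<open>L2 weighted_measure\<close> is the weighted space $L^2_w(0,1)$.\<close>

definition weighted_measure :: "real measure" where
  "weighted_measure = density unit_measure (\<lambda>x. ennreal (weight x))"


section \<open>Wiener process and Wiener integral\<close>

text \<open>The increment of \<open>W\<close> over an interval of length \<open>h\<close> has variance $c^2 h$;
  \<open>normal_density\<close> takes the mean and the standard deviation.\<close>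

locale wiener_process = prob_space M
  for M :: "'a measure" and c :: real and W :: "real \<Rightarrow> 'a \<Rightarrow> real" +
  assumes c_pos: "c > 0"
    and measurable_W: "\<And>t. t \<ge> 0 \<Longrightarrow> W t \<in> borel_measurable M"
    and starts_at_0: "AE \<omega> in M. W 0 \<omega> = 0"
    and indep_increments:
      "\<And>(m::nat) \<tau>. \<tau> 0 \<ge> 0 \<Longrightarrow> (\<And>i. i < m \<Longrightarrow> \<tau> i < \<tau> (Suc i)) \<Longrightarrow>
         indep_vars (\<lambda>_. borel) (\<lambda>i \<omega>. W (\<tau> (Suc i)) \<omega> - W (\<tau> i) \<omega>) {..<m}"
    and normal_increments:
      "\<And>s t. 0 \<le> s \<Longrightarrow> s < t \<Longrightarrow>
         distributed M lborel (\<lambda>\<omega>. W t \<omega> - W s \<omega>) (normal_density 0 (c * sqrt (t - s)))"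
    and continuous_paths: "AE \<omega> in M. continuous_on {0..} (\<lambda>t. W t \<omega>)"

text \<open>\<open>X\<close> is the elementary integral over $[0,1]$ of the step function \<open>f\<close>.\<close>

definition elementary_integral ::
    "(real \<Rightarrow> 'a \<Rightarrow> real) \<Rightarrow> (real \<Rightarrow> real) \<Rightarrow> ('a \<Rightarrow> real) \<Rightarrow> bool" where
  "elementary_integral W f X \<longleftrightarrow>
     (\<exists>(m::nat) \<tau> a. 0 \<le> \<tau> 0 \<and> \<tau> m \<le> 1 \<and> (\<forall>i<m. \<tau> i < \<tau> (Suc i)) \<and>
        f = (\<lambda>s. \<Sum>i<m. a i * indicator {\<tau> i<..\<tau> (Suc i)} s) \<and>
        X = (\<lambda>\<omega>. \<Sum>i<m. a i * (W (\<tau> (Suc i)) \<omega> - W (\<tau> i) \<omega>)))"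

text \<open>Integrals of $L^2(0,1)$ functions are quadratic-mean limits of elementary integrals;
  they are determined only up to null sets, and \<open>wiener_integral\<close> picks one version.\<close>

definition has_wiener_integral ::
    "'a measure \<Rightarrow> (real \<Rightarrow> 'a \<Rightarrow> real) \<Rightarrow> (real \<Rightarrow> real) \<Rightarrow> ('a \<Rightarrow> real) \<Rightarrow> bool" where
  "has_wiener_integral M W f X \<longleftrightarrow>
     (\<exists>F Y. (\<forall>n. elementary_integral W (F n) (Y n)) \<and>
        L2_tendsto unit_measure F f \<and> L2_tendsto M Y X)"

definition wiener_integral ::
    "'a measure \<Rightarrow> (real \<Rightarrow> 'a \<Rightarrow> real) \<Rightarrow> (real \<Rightarrow> real) \<Rightarrow> 'a \<Rightarrow> real" where
  "wiener_integral M W f = (SOME X. has_wiener_integral M W f X)"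

end

theory Submission
  imports Defs
begin

text \<open>
  Both series in the theorem are expansions along orthonormal systems, and the Wiener integral
  \<open>I\<close> carries one into the other. Put \<open>a k = b k * thermite_fun \<alpha> k t\<close>. Multiplication by
  \<open>sqrt w\<close> maps the weighted space isometrically into the unweighted one, so that
  \<open>B k = I (thermite_fun \<alpha> k * sqrt w)\<close>, and since \<open>I\<close> is, up to the factor $c^2$, an isometry,
  $$E\,\Bigl|\sum_{k<n} a_k B_k - I(G\sqrt w)\Bigr|^2
     = c^2 \int_0^1 \Bigl|\sum_{k<n} a_k \tilde\psi_k - G\Bigr|^2 w .$$
  The right-hand side tends to 0 exactly when \<open>G\<close> is the sum of the series in the weighted space.

  It remains to see that such a \<open>G\<close> exists. The substitution \<open>y = logit x\<close> turns \<open>w dx\<close> into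
  Lebesgue measure on the line, so the transformed Hermite functions are orthonormal because the
  Hermite functions are (\<open>thermite_orthonormal\<close>). By Bessel's inequality the \<open>b k\<close> are square
  summable; the factors \<open>thermite_fun \<alpha> k t\<close> are bounded in \<open>k\<close> from some index on
  (\<open>hermite_fun_square_le\<close>), so the \<open>a k\<close> are square summable as well, and completeness
  (\<open>L2_complete\<close>) gives the sum.

  The boundedness comes from the Hermite differential equation \<open>v'' = (x\<^sup>2 - 2n - 1) v\<close>:
  the energy \<open>v'\<^sup>2 + (2n + 1 - x\<^sup>2) v\<^sup>2\<close> has derivative \<open>- 2 x v\<^sup>2\<close> and is therefore largest at 0,
  where the recurrences for Hermite polynomials evaluate it.

  For the Wiener integral, everything is reduced to the covariance
  \<open>E (I f * I g) = c\<^sup>2 * \<integral> f * g\<close> (\<open>wiener_integral_covariance\<close>). For step functions it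
  follows from \<open>E ((W s - W 0) * (W t - W 0)) = c\<^sup>2 * min s t\<close>, which avoids any common
  refinement of partitions, and it passes to limits by the Cauchy--Schwarz inequality. It yields
  the isometry for finite linear combinations without a separate proof that \<open>I\<close> is linear.
  Existence of the integral is density of step functions plus completeness of \<open>L2 M\<close>.
\<close>

section \<open>Square-integrable functions\<close>

lemma L2_iff: "f \<in> L2 N \<longleftrightarrow> f \<in> borel_measurable N \<and> integrable N (\<lambda>x. (f x)\<^sup>2)"
  by (simp add: L2_def)

lemma L2_measurable: "f \<in> L2 N \<Longrightarrow> f \<in> borel_measurable N"
  and L2_integrable_square: "f \<in> L2 N \<Longrightarrow> integrable N (\<lambda>x. (f x)\<^sup>2)"
  by (simp_all add: L2_iff)

lemma L2_integrable_mult: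
  assumes f: "f \<in> L2 N" and g: "g \<in> L2 N"
  shows "integrable N (\<lambda>x. f x * g x)"
proof (rule Bochner_Integration.integrable_bound)
  show "integrable N (\<lambda>x. (f x)\<^sup>2 + (g x)\<^sup>2)"
    using f g by (simp add: L2_iff)
  show "(\<lambda>x. f x * g x) \<in> borel_measurable N"
    by (intro borel_measurable_times L2_measurable f g)
  have "\<bar>a * b\<bar> \<le> \<bar>a\<^sup>2 + b\<^sup>2\<bar>" for a b :: real
  proof -
    have "0 \<le> (\<bar>a\<bar> - \<bar>b\<bar>)\<^sup>2 + \<bar>a\<bar> * \<bar>b\<bar> * 2" "0 \<le> \<bar>a\<bar> * \<bar>b\<bar>" by simp_all
    moreover have "(\<bar>a\<bar> - \<bar>b\<bar>)\<^sup>2 = a\<^sup>2 + b\<^sup>2 - 2 * (\<bar>a\<bar> * \<bar>b\<bar>)"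
      by (simp add: power2_diff)
    ultimately have "\<bar>a\<bar> * \<bar>b\<bar> \<le> a\<^sup>2 + b\<^sup>2"
      using zero_le_power2[of "\<bar>a\<bar> - \<bar>b\<bar>"] by linarith
    then show ?thesis by (simp add: abs_mult)
  qed
  then show "AE x in N. norm (f x * g x) \<le> norm ((f x)\<^sup>2 + (g x)\<^sup>2)" by simp
qed

lemma L2_cmult: "f \<in> L2 N \<Longrightarrow> (\<lambda>x. a * f x) \<in> L2 N"
  unfolding L2_iff by (auto simp: power_mult_distrib intro!: borel_measurable_times)

lemma L2_add:
  assumes "f \<in> L2 N" "g \<in> L2 N"
  shows "(\<lambda>x. f x + g x) \<in> L2 N"
proof -
  have "integrable N (\<lambda>x. (f x)\<^sup>2 + (g x)\<^sup>2 + 2 * (f x * g x))"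
    using assms L2_integrable_mult[OF assms] by (simp add: L2_iff)
  then show ?thesis
    using assms unfolding L2_iff
    by (auto simp: power2_sum mult.assoc intro!: borel_measurable_add)
qed

lemma L2_diff:
  assumes "f \<in> L2 N" "g \<in> L2 N"
  shows "(\<lambda>x. f x - g x) \<in> L2 N"
  using L2_add[OF assms(1) L2_cmult[OF assms(2), of "-1"]] by simp

lemma L2_sum:
  assumes "\<And>i. i \<in> I \<Longrightarrow> f i \<in> L2 N"
  shows "(\<lambda>x. \<Sum>i\<in>I. f i x) \<in> L2 N"
  using assms
proof (induction I rule: infinite_finite_induct)
  case (insert i I)
  then show ?case using L2_add[of "f i" N "\<lambda>x. \<Sum>i\<in>I. f i x"] by simp
qed (simp_all add: L2_iff)

lemma L2_tendsto_iff:
  "L2_tendsto N F f \<longleftrightarrow>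
     (\<forall>n. F n \<in> L2 N) \<and> f \<in> L2 N \<and> (\<lambda>n. LINT x|N. (F n x - f x)\<^sup>2) \<longlonglongrightarrow> 0"
  by (simp add: L2_tendsto_def)

lemma integral_sum_mult_sum:
  assumes "finite I" "finite J" "\<And>i. i \<in> I \<Longrightarrow> u i \<in> L2 N" "\<And>j. j \<in> J \<Longrightarrow> v j \<in> L2 N"
  shows "(LINT x|N. (\<Sum>i\<in>I. a i * u i x) * (\<Sum>j\<in>J. d j * v j x)) =
    (\<Sum>i\<in>I. \<Sum>j\<in>J. a i * d j * (LINT x|N. u i x * v j x))"
proof -
  have eq: "(\<Sum>i\<in>I. a i * u i x) * (\<Sum>j\<in>J. d j * v j x) =
      (\<Sum>i\<in>I. \<Sum>j\<in>J. a i * d j * (u i x * v j x))" for x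
    by (simp add: sum_product mult_ac)
  have "integrable N (\<lambda>x. a i * d j * (u i x * v j x))" if "i \<in> I" "j \<in> J" for i j
    using L2_integrable_mult[OF assms(3,4)] that by simp
  then show ?thesis
    unfolding eq by (simp add: Bochner_Integration.integral_sum)
qed

text \<open>The quadratic \<open>s \<mapsto> \<integral> (s * v + u)\<^sup>2\<close> is nonnegative, so its discriminant is not positive.\<close>

lemma L2_cauchy_schwarz:
  assumes u: "u \<in> L2 N" and v: "v \<in> L2 N"
  shows "\<bar>LINT x|N. u x * v x\<bar> \<le> sqrt (LINT x|N. (u x)\<^sup>2) * sqrt (LINT x|N. (v x)\<^sup>2)"
proof -
  define A B C where "A = (LINT x|N. (v x)\<^sup>2)" and "B = (LINT x|N. u x * v x)"
    and "C = (LINT x|N. (u x)\<^sup>2)"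
  have "A * s\<^sup>2 + (2 * B) * s + C \<ge> 0" for s
  proof -
    have "(LINT x|N. (s * v x + u x)\<^sup>2) =
        (LINT x|N. s\<^sup>2 * (v x)\<^sup>2 + 2 * s * (u x * v x) + (u x)\<^sup>2)"
      by (intro Bochner_Integration.integral_cong) (auto simp: power2_eq_square algebra_simps)
    also have "\<dots> = s\<^sup>2 * A + 2 * s * B + C"
      using u v L2_integrable_mult[OF u v] by (simp add: L2_iff A_def B_def C_def)
    finally have "A * s\<^sup>2 + (2 * B) * s + C = (LINT x|N. (s * v x + u x)\<^sup>2)"
      by (simp add: mult_ac)
    then show ?thesis by simp
  qed
  then have pos: "A * s\<^sup>2 + 2 * B * s + C \<ge> 0" for s by simp
  have "A \<ge> 0" by (simp add: A_def)
  have "B\<^sup>2 \<le> C * A"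
  proof (cases "A = 0")
    case True
    have "B = 0"
    proof (rule ccontr)
      assume "B \<noteq> 0"
      then show False using pos[of "- (C + 1) / (2 * B)"] True by simp
    qed
    then show ?thesis using True by simp
  next
    case False
    then have "A * (- B / A)\<^sup>2 + 2 * B * (- B / A) + C = C - B\<^sup>2 / A"
      by (simp add: power2_eq_square field_simps)
    then have "B\<^sup>2 / A \<le> C" using pos[of "- B / A"] by linarith
    then show ?thesis using False \<open>A \<ge> 0\<close> by (simp add: pos_divide_le_eq)
  qed
  then have "sqrt (B\<^sup>2) \<le> sqrt (C * A)" by (rule real_sqrt_le_mono)
  then show ?thesis by (simp add: real_sqrt_mult A_def B_def C_def)
qed

text \<open>Along a subsequence the squared distances of consecutive members are below \<open>(1/4) ^ k\<close>. The
  weights \<open>2 ^ k\<close> keep the series of these squares integrable and at the same time dominate the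
  increments themselves pointwise, by the inequality \<open>d \<le> p * d\<^sup>2 + 1 / p\<close>. So the subsequence
  converges almost everywhere, and Fatou's lemma shows that its limit is the limit in quadratic
  mean of the whole sequence. The measure need not be finite: the weighted space has infinite mass.\<close>

lemma L2_complete:
  assumes F: "\<And>n. F n \<in> L2 N"
    and Cauchy: "\<And>e. e > 0 \<Longrightarrow> \<exists>K. \<forall>m\<ge>K. \<forall>n\<ge>K. (LINT x|N. (F m x - F n x)\<^sup>2) < e"
  shows "\<exists>f. L2_tendsto N F f"
proof -
  have "\<forall>k. \<exists>K. \<forall>m\<ge>K. \<forall>n\<ge>K. (LINT x|N. (F m x - F n x)\<^sup>2) < (1/4) ^ k"
    using Cauchy by simp
  then obtain K where K: "\<And>k m n. m \<ge> K k \<Longrightarrow> n \<ge> K k \<Longrightarrow>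
      (LINT x|N. (F m x - F n x)\<^sup>2) < (1/4) ^ k"
    by metis
  define r where "r k = (\<Sum>j\<le>k. K j)" for k
  have r: "r j \<ge> K k" if "j \<ge> k" for j k
    unfolding r_def by (rule member_le_sum) (use that in auto)
  have meas [measurable]: "F n \<in> borel_measurable N" for n
    using F by (simp add: L2_iff)
  have sq_int: "integrable N (\<lambda>x. (F m x - F n x)\<^sup>2)" for m n
    using L2_diff[OF F F] by (simp add: L2_iff)
  define D where "D k x = F (r (Suc k)) x - F (r k) x" for k x
  have [measurable]: "D k \<in> borel_measurable N" for k
    unfolding D_def by measurable
  have "(\<integral>\<^sup>+x. (\<Sum>k. ennreal (2 ^ k * (D k x)\<^sup>2)) \<partial>N) =
      (\<Sum>k. \<integral>\<^sup>+x. ennreal (2 ^ k * (D k x)\<^sup>2) \<partial>N)"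
    by (rule nn_integral_suminf) measurable
  also have "\<dots> \<le> (\<Sum>k. ennreal ((1/2) ^ k))"
  proof (rule suminf_le)
    fix k
    have "(\<integral>\<^sup>+x. ennreal (2 ^ k * (D k x)\<^sup>2) \<partial>N) = ennreal (LINT x|N. 2 ^ k * (D k x)\<^sup>2)"
      unfolding D_def by (rule nn_integral_eq_integral) (use sq_int in auto)
    also have "\<dots> = ennreal (2 ^ k * (LINT x|N. (D k x)\<^sup>2))" by simp
    also have "\<dots> \<le> ennreal (2 ^ k * (1/4) ^ k)"
      unfolding D_def using K[of k "r (Suc k)" "r k"] r
      by (intro ennreal_leI mult_left_mono) (auto intro: less_imp_le)
    also have "2 ^ k * (1/4) ^ k = ((1/2) ^ k :: real)"
      by (simp flip: power_mult_distrib)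
    finally show "(\<integral>\<^sup>+x. ennreal (2 ^ k * (D k x)\<^sup>2) \<partial>N) \<le> ennreal ((1/2) ^ k)" .
  qed auto
  also have "\<dots> = ennreal (\<Sum>k. (1/2) ^ k)"
    by (rule suminf_ennreal2) (auto intro: summable_geometric)
  also have "\<dots> < \<infinity>" by simp
  finally have "(\<integral>\<^sup>+x. (\<Sum>k. ennreal (2 ^ k * (D k x)\<^sup>2)) \<partial>N) \<noteq> \<infinity>" by simp
  then have "AE x in N. (\<Sum>k. ennreal (2 ^ k * (D k x)\<^sup>2)) \<noteq> \<infinity>"
    by (rule nn_integral_PInf_AE[rotated]) measurable
  then have conv: "AE x in N. convergent (\<lambda>k. F (r k) x)"
  proof eventually_elim
    case (elim x)
    have sm: "summable (\<lambda>k. 2 ^ k * (D k x)\<^sup>2)"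
      using elim by (intro summable_suminf_not_top) auto
    have amgm: "\<bar>d\<bar> \<le> p * d\<^sup>2 + 1 / p" if "p > 0" for p d :: real
    proof -
      have "0 \<le> (p * \<bar>d\<bar> - 1)\<^sup>2 + p * \<bar>d\<bar>" using that by simp
      then have "\<bar>d\<bar> * p \<le> p\<^sup>2 * d\<^sup>2 + 1"
        by (simp add: power2_diff power_mult_distrib mult.commute)
      then have "\<bar>d\<bar> \<le> (p\<^sup>2 * d\<^sup>2 + 1) / p"
        using that by (simp add: pos_le_divide_eq)
      also have "\<dots> = p * d\<^sup>2 + 1 / p"
        using that by (simp add: add_divide_distrib power2_eq_square)
      finally show ?thesis .
    qed
    have bound: "\<bar>D k x\<bar> \<le> 2 ^ k * (D k x)\<^sup>2 + (1/2) ^ k" for k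
      using amgm[of "2 ^ k" "D k x"] by (simp add: power_one_over)
    have "summable (\<lambda>k. 2 ^ k * (D k x)\<^sup>2 + (1/2) ^ k)"
      using sm by (intro summable_add summable_geometric) auto
    then have "summable (\<lambda>k. D k x)"
      by (rule summable_comparison_test[rotated]) (use bound in auto)
    then have "convergent (\<lambda>n. \<Sum>k<n. D k x)" by (simp add: summable_iff_convergent)
    moreover have "(\<Sum>k<n. D k x) = F (r n) x - F (r 0) x" for n
      unfolding D_def by (rule sum_lessThan_telescope)
    ultimately have "convergent (\<lambda>n. F (r n) x - F (r 0) x)" by simp
    then show ?case by (simp add: convergent_diff_const_right_iff)
  qed
  define f where "f x = lim (\<lambda>k. F (r k) x)" for x
  have [measurable]: "f \<in> borel_measurable N"
    unfolding f_def by (rule borel_measurable_lim_metric) measurable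
  have lim: "AE x in N. (\<lambda>k. F (r k) x) \<longlonglongrightarrow> f x"
    using conv unfolding f_def by eventually_elim (simp add: convergent_LIMSEQ_iff)
  have fatou: "(\<integral>\<^sup>+x. ennreal ((F m x - f x)\<^sup>2) \<partial>N) \<le> ennreal ((1/4) ^ k)" if "m \<ge> K k" for m k
  proof -
    have "(\<integral>\<^sup>+x. ennreal ((F m x - f x)\<^sup>2) \<partial>N) =
        (\<integral>\<^sup>+x. liminf (\<lambda>j. ennreal ((F m x - F (r j) x)\<^sup>2)) \<partial>N)"
      using lim
      by (intro nn_integral_cong_AE, eventually_elim)
        (intro lim_imp_Liminf[symmetric] tendsto_ennrealI tendsto_power tendsto_diff tendsto_const, auto)
    also have "\<dots> \<le> liminf (\<lambda>j. \<integral>\<^sup>+x. ennreal ((F m x - F (r j) x)\<^sup>2) \<partial>N)"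
      by (rule nn_integral_liminf) measurable
    also have "\<dots> \<le> ennreal ((1/4) ^ k)"
    proof (rule Liminf_le)
      show "\<forall>\<^sub>F j in sequentially. (\<integral>\<^sup>+x. ennreal ((F m x - F (r j) x)\<^sup>2) \<partial>N) \<le> ennreal ((1/4) ^ k)"
        using eventually_ge_at_top[of k]
      proof eventually_elim
        case (elim j)
        have "(\<integral>\<^sup>+x. ennreal ((F m x - F (r j) x)\<^sup>2) \<partial>N) =
            ennreal (LINT x|N. (F m x - F (r j) x)\<^sup>2)"
          by (rule nn_integral_eq_integral) (use sq_int in auto)
        then show ?case
          using K[OF that r[OF elim]] by (simp add: ennreal_leI)
      qed
    qed simp
    finally show ?thesis .
  qed
  have int: "integrable N (\<lambda>x. (F m x - f x)\<^sup>2)"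
    and bound: "(LINT x|N. (F m x - f x)\<^sup>2) \<le> (1/4) ^ k" if "m \<ge> K k" for m k
  proof -
    show "integrable N (\<lambda>x. (F m x - f x)\<^sup>2)"
      by (rule integrableI_bounded) (use fatou[OF that] in \<open>auto intro: le_less_trans\<close>)
    then have "ennreal (LINT x|N. (F m x - f x)\<^sup>2) = (\<integral>\<^sup>+x. ennreal ((F m x - f x)\<^sup>2) \<partial>N)"
      by (rule nn_integral_eq_integral[symmetric]) auto
    then have "ennreal (LINT x|N. (F m x - f x)\<^sup>2) \<le> ennreal ((1/4) ^ k)"
      using fatou[OF that] by simp
    then show "(LINT x|N. (F m x - f x)\<^sup>2) \<le> (1/4) ^ k"
      by (simp add: ennreal_le_iff)
  qed
  have "(\<lambda>x. F (K 0) x - f x) \<in> L2 N"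
    using int[of 0 "K 0"] by (simp add: L2_iff)
  then have "f \<in> L2 N"
    using L2_diff[OF F[of "K 0"], of "\<lambda>x. F (K 0) x - f x"] by simp
  moreover have "(\<lambda>m. LINT x|N. (F m x - f x)\<^sup>2) \<longlonglongrightarrow> 0"
  proof (rule LIMSEQ_I)
    fix e :: real assume "e > 0"
    then obtain k where k: "(1/4) ^ k < e"
      using real_arch_pow_inv[of e "1/4"] by force
    have "norm ((LINT x|N. (F m x - f x)\<^sup>2) - 0) < e" if "m \<ge> K k" for m
    proof -
      have "0 \<le> (LINT x|N. (F m x - f x)\<^sup>2)" by simp
      then show ?thesis using bound[OF that] k by (simp only: real_norm_def diff_0_right abs_of_nonneg)
    qed
    then show "\<exists>no. \<forall>m\<ge>no. norm ((LINT x|N. (F m x - f x)\<^sup>2) - 0) < e" by blast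
  qed
  ultimately show ?thesis using F by (auto simp: L2_tendsto_iff)
qed

lemma integral_diff_mult_diff:
  assumes "u \<in> L2 N" "u' \<in> L2 N" "v \<in> L2 N" "v' \<in> L2 N"
  shows "(LINT x|N. (u x - u' x) * (v x - v' x)) =
    (LINT x|N. u x * v x) - (LINT x|N. u x * v' x) - (LINT x|N. u' x * v x) + (LINT x|N. u' x * v' x)"
proof -
  have "(LINT x|N. (u x - u' x) * (v x - v' x)) =
      (LINT x|N. u x * v x - u x * v' x - u' x * v x + u' x * v' x)"
    by (simp add: algebra_simps)
  then show ?thesis
    using assms by (simp add: L2_integrable_mult)
qed

lemma L2_tendsto_inner:
  assumes F: "L2_tendsto N F f" and G: "L2_tendsto N G g"
  shows "(\<lambda>n. LINT x|N. F n x * G n x) \<longlonglongrightarrow> (LINT x|N. f x * g x)"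
proof -
  have L2: "F n \<in> L2 N" "G n \<in> L2 N" "f \<in> L2 N" "g \<in> L2 N" for n
    using F G by (auto simp: L2_tendsto_iff)
  define d e where "d n = sqrt (LINT x|N. (F n x - f x)\<^sup>2)" and "e n = sqrt (LINT x|N. (G n x - g x)\<^sup>2)" for n
  have d: "d \<longlonglongrightarrow> 0" and e: "e \<longlonglongrightarrow> 0"
    using F G tendsto_real_sqrt[of "\<lambda>n. LINT x|N. (F n x - f x)\<^sup>2" 0]
      tendsto_real_sqrt[of "\<lambda>n. LINT x|N. (G n x - g x)\<^sup>2" 0]
    by (simp_all add: L2_tendsto_iff d_def[abs_def] e_def[abs_def])
  define A B where "A = sqrt (LINT x|N. (f x)\<^sup>2)" and "B = sqrt (LINT x|N. (g x)\<^sup>2)"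
  have "norm ((LINT x|N. F n x * G n x) - (LINT x|N. f x * g x)) \<le> d n * e n + d n * B + A * e n" for n
  proof -
    have "(LINT x|N. F n x * G n x) - (LINT x|N. f x * g x) =
        (LINT x|N. F n x * G n x - f x * g x)"
      using L2 by (simp add: L2_integrable_mult)
    also have "\<dots> = (LINT x|N. (F n x - f x) * (G n x - g x) + (F n x - f x) * g x + f x * (G n x - g x))"
      by (simp add: algebra_simps)
    also have "\<dots> = (LINT x|N. (F n x - f x) * (G n x - g x)) + (LINT x|N. (F n x - f x) * g x)
        + (LINT x|N. f x * (G n x - g x))"
      using L2_integrable_mult[OF L2_diff[OF L2(1,3)] L2_diff[OF L2(2,4)]]
        L2_integrable_mult[OF L2_diff[OF L2(1,3)] L2(4)] L2_integrable_mult[OF L2(3) L2_diff[OF L2(2,4)]]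
      by simp
    finally show ?thesis
      using L2_cauchy_schwarz[OF L2_diff[OF L2(1,3)] L2_diff[OF L2(2,4)], of n n]
        L2_cauchy_schwarz[OF L2_diff[OF L2(1,3)] L2(4), of n] L2_cauchy_schwarz[OF L2(3) L2_diff[OF L2(2,4)], of n]
      unfolding real_norm_def d_def e_def A_def B_def by linarith
  qed
  then have bound: "\<forall>\<^sub>F n in sequentially.
      norm ((LINT x|N. F n x * G n x) - (LINT x|N. f x * g x)) \<le> d n * e n + d n * B + A * e n"
    by (intro always_eventually allI)
  have "(\<lambda>n. d n * e n + d n * B + A * e n) \<longlonglongrightarrow> 0 * 0 + 0 * B + A * 0"
    by (intro tendsto_intros d e)
  then have "(\<lambda>n. d n * e n + d n * B + A * e n) \<longlonglongrightarrow> 0" by simp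
  then have "(\<lambda>n. (LINT x|N. F n x * G n x) - (LINT x|N. f x * g x)) \<longlonglongrightarrow> 0"
    by (rule Lim_null_comparison[OF bound])
  then show ?thesis by (simp add: LIM_zero_iff)
qed

lemma square_add_le: "(a + b)\<^sup>2 \<le> 2 * a\<^sup>2 + 2 * b\<^sup>2" for a b :: real
  using zero_le_power2[of "a - b"] by (simp add: power2_diff power2_sum)

lemma integral_square_triangle:
  assumes "u \<in> L2 N" "v \<in> L2 N" "w \<in> L2 N"
  shows "(LINT x|N. (u x - w x)\<^sup>2) \<le> 2 * (LINT x|N. (u x - v x)\<^sup>2) + 2 * (LINT x|N. (v x - w x)\<^sup>2)"
proof -
  have int: "integrable N (\<lambda>x. (u x - v x)\<^sup>2)" "integrable N (\<lambda>x. (v x - w x)\<^sup>2)" "integrable N (\<lambda>x. (u x - w x)\<^sup>2)"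
    using assms by (auto intro!: L2_integrable_square L2_diff)
  have "(LINT x|N. (u x - w x)\<^sup>2) \<le> (LINT x|N. 2 * (u x - v x)\<^sup>2 + 2 * (v x - w x)\<^sup>2)"
    using int square_add_le[of "u x - v x" "v x - w x" for x]
    by (intro integral_mono) auto
  then show ?thesis using int by simp
qed

lemma L2_dominated_convergence:
  fixes w :: "'a \<Rightarrow> real"
  assumes h: "\<And>n. h n \<in> borel_measurable N" and f: "f \<in> borel_measurable N"
    and w: "integrable N w"
    and lim: "AE x in N. (\<lambda>n. h n x) \<longlonglongrightarrow> f x"
    and bound: "\<And>n. AE x in N. (h n x - f x)\<^sup>2 \<le> w x"
  shows "(\<lambda>n. LINT x|N. (h n x - f x)\<^sup>2) \<longlonglongrightarrow> 0"
proof -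
  have "(\<lambda>n. LINT x|N. (h n x - f x)\<^sup>2) \<longlonglongrightarrow> (LINT x|N. 0)"
  proof (rule integral_dominated_convergence[where w = w])
    show "AE x in N. (\<lambda>n. (h n x - f x)\<^sup>2) \<longlonglongrightarrow> 0"
      using lim
    proof eventually_elim
      case (elim x)
      then have "(\<lambda>n. (h n x - f x)\<^sup>2) \<longlonglongrightarrow> (f x - f x)\<^sup>2" by (intro tendsto_intros)
      then show ?case by simp
    qed
    show "(\<lambda>x. (h n x - f x)\<^sup>2) \<in> borel_measurable N" for n
      using h f by measurable
    show "AE x in N. norm ((h n x - f x)\<^sup>2) \<le> w x" for n
      using bound[of n] by simp
  qed (use w in auto)
  then show ?thesis by simp
qed

section \<open>Orthonormal series\<close>

lemma integral_orthonormal_sum_square: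
  assumes u: "\<And>k. u k \<in> L2 N"
    and orth: "\<And>i j. (LINT x|N. u i x * u j x) = (if i = j then 1 else 0)"
    and "finite I"
  shows "(LINT x|N. (\<Sum>i\<in>I. a i * u i x)\<^sup>2) = (\<Sum>i\<in>I. (a i)\<^sup>2)"
proof -
  have "(LINT x|N. (\<Sum>i\<in>I. a i * u i x)\<^sup>2) =
      (\<Sum>i\<in>I. \<Sum>j\<in>I. a i * a j * (LINT x|N. u i x * u j x))"
    unfolding power2_eq_square using assms by (intro integral_sum_mult_sum) auto
  also have "\<dots> = (\<Sum>i\<in>I. (a i)\<^sup>2)"
    using \<open>finite I\<close> by (simp add: orth if_distrib sum.delta' power2_eq_square cong: if_cong)
  finally show ?thesis .
qed

lemma integral_diff_square:
  assumes "u \<in> L2 N" "v \<in> L2 N"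
  shows "(LINT x|N. (u x - v x)\<^sup>2) =
    (LINT x|N. u x * u x) - 2 * (LINT x|N. u x * v x) + (LINT x|N. v x * v x)"
proof -
  have "(LINT x|N. (u x - v x)\<^sup>2) = (LINT x|N. u x * u x - 2 * (u x * v x) + v x * v x)"
    by (simp add: power2_eq_square algebra_simps)
  then show ?thesis
    using assms by (simp add: L2_integrable_mult)
qed

text \<open>Expanding \<open>0 \<le> \<integral> (\<Sum>k<n. b k * u k - g)\<^sup>2\<close> bounds the partial sums of the squares by
  \<open>\<integral> g\<^sup>2\<close>.\<close>

lemma bessel_summable:
  assumes u: "\<And>k. u k \<in> L2 N"
    and orth: "\<And>i j. (LINT x|N. u i x * u j x) = (if i = j then 1 else 0)"
    and g: "g \<in> L2 N"
  shows "summable (\<lambda>k. (LINT x|N. u k x * g x)\<^sup>2)"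
proof (rule summableI_nonneg_bounded)
  fix n :: nat
  define b where "b k = (LINT x|N. u k x * g x)" for k
  define S where "S x = (\<Sum>k<n. b k * u k x)" for x
  have S: "S \<in> L2 N" unfolding S_def by (intro L2_sum L2_cmult u)
  have "(LINT x|N. S x * S x) = (\<Sum>k<n. (b k)\<^sup>2)"
    using integral_orthonormal_sum_square[OF u orth, of "{..<n}" b]
    by (simp add: S_def power2_eq_square)
  moreover have "(LINT x|N. S x * g x) = (\<Sum>k<n. (b k)\<^sup>2)"
  proof -
    have "(LINT x|N. S x * g x) = (LINT x|N. (\<Sum>k<n. b k * (u k x * g x)))"
      by (simp add: S_def sum_distrib_right mult.assoc)
    also have "\<dots> = (\<Sum>k<n. b k * (LINT x|N. u k x * g x))"
      using L2_integrable_mult[OF u g] by (simp add: Bochner_Integration.integral_sum)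
    finally show ?thesis by (simp add: b_def power2_eq_square)
  qed
  moreover have "0 \<le> (LINT x|N. (S x - g x)\<^sup>2)" by simp
  ultimately show "(\<Sum>k<n. (LINT x|N. u k x * g x)\<^sup>2) \<le> (LINT x|N. g x * g x)"
    unfolding integral_diff_square[OF S g] b_def by linarith
qed simp

lemma orthonormal_series_converges:
  assumes u: "\<And>k. u k \<in> L2 N"
    and orth: "\<And>i j. (LINT x|N. u i x * u j x) = (if i = j then 1 else 0)"
    and sm: "summable (\<lambda>k. (a k)\<^sup>2)"
  shows "\<exists>G. L2_sums N (\<lambda>k x. a k * u k x) G"
  unfolding L2_sums_def
proof (rule L2_complete)
  show "(\<lambda>x. \<Sum>k<n. a k * u k x) \<in> L2 N" for n
    by (intro L2_sum L2_cmult u)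
  fix e :: real assume "e > 0"
  then obtain K where K: "\<And>m n. m \<ge> K \<Longrightarrow> norm (\<Sum>k=m..<n. (a k)\<^sup>2) < e"
    using sm unfolding summable_Cauchy by blast
  define S where "S n x = (\<Sum>k<n. a k * u k x)" for n x
  have *: "(LINT x|N. (S n x - S m x)\<^sup>2) < e" if "K \<le> m" "m \<le> n" for m n
  proof -
    have "S n x - S m x = (\<Sum>k=m..<n. a k * u k x)" for x
      unfolding S_def using that by (subst sum_diff[symmetric]) (auto intro!: sum.cong)
    then have "(LINT x|N. (S n x - S m x)\<^sup>2) = (\<Sum>k=m..<n. (a k)\<^sup>2)"
      using integral_orthonormal_sum_square[OF u orth, of "{m..<n}" a] by simp
    also have "\<dots> < e" using K[OF \<open>K \<le> m\<close>, of n] by simp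
    finally show ?thesis .
  qed
  have "(LINT x|N. (S m x - S n x)\<^sup>2) < e" if "K \<le> m" "K \<le> n" for m n
  proof (cases "m \<le> n")
    case True
    have "(S m x - S n x)\<^sup>2 = (S n x - S m x)\<^sup>2" for x by (rule power2_commute)
    then show ?thesis using *[OF that(1) True] by simp
  next
    case False
    then show ?thesis using *[of n m] that by simp
  qed
  then show "\<exists>K. \<forall>m\<ge>K. \<forall>n\<ge>K. (LINT x|N. ((\<Sum>k<m. a k * u k x) - (\<Sum>k<n. a k * u k x))\<^sup>2) < e"
    unfolding S_def by (intro exI[of _ K] allI impI)
qed

section \<open>Hermite functions\<close>

text \<open>The recursion is what differentiating \<open>p x * exp (- x\<^sup>2)\<close> does to the polynomial factor, up to
  the sign that the Rodrigues formula takes out.\<close>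

fun hermite_poly :: "nat \<Rightarrow> real poly" where
  "hermite_poly 0 = 1"
| "hermite_poly (Suc n) = [:0, 2:] * hermite_poly n - pderiv (hermite_poly n)"

lemma pderiv_hermite_poly:
  "pderiv (hermite_poly (Suc n)) = smult (2 * real (Suc n)) (hermite_poly n)"
proof (induction n)
  case 0
  show ?case by (simp add: pderiv_pCons)
next
  case (Suc n)
  let ?h = hermite_poly
  have "pderiv (?h (Suc (Suc n))) = smult 2 (?h (Suc n)) +
      ([:0, 2:] * pderiv (?h (Suc n)) - pderiv (pderiv (?h (Suc n))))"
    by (simp add: pderiv_diff pderiv_mult pderiv_pCons del: hermite_poly.simps(2)
        add: hermite_poly.simps(2)[of "Suc n"] pderiv_smult)
  also have "\<dots> = smult 2 (?h (Suc n)) + smult (2 * real (Suc n)) (?h (Suc n))"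
    unfolding Suc.IH
    by (simp only: pderiv_smult mult_smult_right smult_diff_right[symmetric] hermite_poly.simps(2)[of n])
  also have "\<dots> = smult (2 * real (Suc (Suc n))) (?h (Suc n))"
    by (simp add: smult_add_left[symmetric] del: hermite_poly.simps(2))
  finally show ?case .
qed

lemma has_derivative_poly_gauss:
  fixes p :: "real poly"
  shows "((\<lambda>x. poly p x * exp (- x\<^sup>2)) has_real_derivative
      - poly ([:0, 2:] * p - pderiv p) x * exp (- x\<^sup>2)) (at x)"
  by (auto intro!: derivative_eq_intros poly_DERIV simp: algebra_simps)

lemma hermite_H_eq_poly: "hermite_H n t = poly (hermite_poly n) t"
proof -
  have "(deriv ^^ n) (\<lambda>x. exp (- x\<^sup>2)) =
      (\<lambda>x. (-1) ^ n * (poly (hermite_poly n) x * exp (- x\<^sup>2)))" for n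
  proof (induction n)
    case (Suc n)
    show ?case
    proof
      fix x :: real
      have "((\<lambda>x. (-1) ^ n * (poly (hermite_poly n) x * exp (- x\<^sup>2))) has_real_derivative
          (-1) ^ n * (- poly (hermite_poly (Suc n)) x * exp (- x\<^sup>2))) (at x)"
        using has_derivative_poly_gauss[of "hermite_poly n" x]
        by (intro DERIV_cmult) simp
      then show "(deriv ^^ Suc n) (\<lambda>x. exp (- x\<^sup>2)) x =
          (-1) ^ Suc n * (poly (hermite_poly (Suc n)) x * exp (- x\<^sup>2))"
        by (simp add: Suc.IH DERIV_imp_deriv del: hermite_poly.simps)
    qed
  qed simp
  then show ?thesis
    by (simp add: hermite_H_def exp_minus field_simps power_add[symmetric])
qed

lemma integrable_power_gauss: "integrable lborel (\<lambda>x::real. x ^ k * exp (- x\<^sup>2))"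
proof -
  have "integrable lborel (\<lambda>x. normal_density 0 (1 / sqrt 2) x * (x - 0) ^ k)"
    by (rule integrable_normal_moment) simp
  then have "integrable lborel (\<lambda>x. sqrt pi * (normal_density 0 (1 / sqrt 2) x * (x - 0) ^ k))"
    by (rule integrable_mult_right)
  moreover have "sqrt pi * (normal_density 0 (1 / sqrt 2) x * (x - 0) ^ k) = x ^ k * exp (- x\<^sup>2)" for x
    by (simp add: normal_density_def power_one_over real_sqrt_divide)
  ultimately show ?thesis by (simp only:)
qed

lemma integral_gauss: "(LINT x|lborel. exp (- x\<^sup>2)) = sqrt pi"
proof -
  have "(LINT x|lborel. exp (- x\<^sup>2)) = (LINT x|lborel. sqrt pi * normal_density 0 (1 / sqrt 2) x)"
    by (simp add: normal_density_def power_one_over real_sqrt_divide)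
  then show ?thesis by simp
qed

lemma integrable_poly_gauss:
  fixes p :: "real poly"
  shows "integrable lborel (\<lambda>x. poly p x * exp (- x\<^sup>2))"
proof -
  have "integrable lborel (\<lambda>x. \<Sum>i\<le>degree p. coeff p i * (x ^ i * exp (- x\<^sup>2)))"
    by (intro Bochner_Integration.integrable_sum integrable_mult_right impI integrable_power_gauss)
  then show ?thesis
    by (simp add: poly_altdef sum_distrib_right mult.assoc)
qed

lemma tendsto_poly_gauss:
  fixes p :: "real poly"
  shows "((\<lambda>x. poly p x * exp (- x\<^sup>2)) \<longlongrightarrow> 0) at_top" "((\<lambda>x. poly p x * exp (- x\<^sup>2)) \<longlongrightarrow> 0) at_bot"
proof -
  have pow: "((\<lambda>x::real. x ^ k * exp (- x\<^sup>2)) \<longlongrightarrow> 0) at_top" for k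
    by real_asymp
  have top: "((\<lambda>x. poly p x * exp (- x\<^sup>2)) \<longlongrightarrow> 0) at_top" for p :: "real poly"
  proof -
    have "((\<lambda>x. \<Sum>i\<le>degree p. coeff p i * (x ^ i * exp (- x\<^sup>2))) \<longlongrightarrow> (\<Sum>i\<le>degree p. coeff p i * 0)) at_top"
      by (intro tendsto_sum tendsto_mult pow tendsto_const)
    then show ?thesis
      by (simp add: poly_altdef sum_distrib_right mult.assoc)
  qed
  show "((\<lambda>x. poly p x * exp (- x\<^sup>2)) \<longlongrightarrow> 0) at_top" by (rule top)
  show "((\<lambda>x. poly p x * exp (- x\<^sup>2)) \<longlongrightarrow> 0) at_bot"
    using top[of "pcompose p [:0, -1:]"]
    by (simp add: filterlim_at_bot_mirror poly_pcompose)
qed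

text \<open>Up to sign the integrand is the derivative of \<open>p x * exp (- x\<^sup>2)\<close>, which vanishes at both ends
  of the line.\<close>

lemma integral_derivative_poly_gauss:
  fixes p :: "real poly"
  shows "(LINT x|lborel. poly ([:0, 2:] * p - pderiv p) x * exp (- x\<^sup>2)) = 0"
proof -
  let ?q = "- ([:0, 2:] * p - pderiv p)"
  have "(LBINT x=-\<infinity>..\<infinity>. poly ?q x * exp (- x\<^sup>2)) = 0 - 0"
  proof (rule interval_integral_FTC_integrable)
    show "((\<lambda>x. poly p x * exp (- x\<^sup>2)) has_vector_derivative poly ?q x * exp (- x\<^sup>2)) (at x)" for x
      using has_derivative_poly_gauss[of p x]
      by (simp add: has_real_derivative_iff_has_vector_derivative)
    show "isCont (\<lambda>x. poly ?q x * exp (- x\<^sup>2)) x" for x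
      by (intro continuous_intros)
    show "set_integrable lborel (einterval (- \<infinity>) \<infinity>) (\<lambda>x. poly ?q x * exp (- x\<^sup>2))"
      using integrable_poly_gauss[of ?q] by (simp add: set_integrable_def einterval_def)
  qed (use tendsto_poly_gauss[of p] in \<open>simp_all add: ereal_tendsto_simps\<close>)
  then have "(LINT x|lborel. poly ?q x * exp (- x\<^sup>2)) = 0"
    by (simp add: interval_lebesgue_integral_def set_lebesgue_integral_def einterval_def)
  moreover have "(LINT x|lborel. poly ?q x * exp (- x\<^sup>2)) =
      - (LINT x|lborel. poly ([:0, 2:] * p - pderiv p) x * exp (- x\<^sup>2))"
    by (subst Bochner_Integration.integral_minus[symmetric]) (simp only: poly_minus mult_minus_left)
  ultimately show ?thesis by simp
qed

text \<open>Integration by parts: against the Gaussian, raising the degree of one factor is adjoint to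
  differentiating the other.\<close>

lemma hermite_pairing_Suc:
  "(LINT x|lborel. poly (hermite_poly m * hermite_poly (Suc n)) x * exp (- x\<^sup>2)) =
   (LINT x|lborel. poly (pderiv (hermite_poly m) * hermite_poly n) x * exp (- x\<^sup>2))"
proof -
  let ?p = "hermite_poly m * hermite_poly n"
  have "[:0, 2:] * ?p - pderiv ?p =
      hermite_poly m * hermite_poly (Suc n) - pderiv (hermite_poly m) * hermite_poly n"
    by (simp add: pderiv_mult algebra_simps)
  then have "0 = (LINT x|lborel. poly (hermite_poly m * hermite_poly (Suc n)) x * exp (- x\<^sup>2)
      - poly (pderiv (hermite_poly m) * hermite_poly n) x * exp (- x\<^sup>2))"
    using integral_derivative_poly_gauss[of ?p] by (simp only: poly_diff left_diff_distrib)
  also have "\<dots> = (LINT x|lborel. poly (hermite_poly m * hermite_poly (Suc n)) x * exp (- x\<^sup>2))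
      - (LINT x|lborel. poly (pderiv (hermite_poly m) * hermite_poly n) x * exp (- x\<^sup>2))"
    by (intro Bochner_Integration.integral_diff integrable_poly_gauss)
  finally show ?thesis by simp
qed

text \<open>Each integration by parts lowers both degrees by one and, as \<open>H\<^sub>m' = 2 m H\<^sub>m\<^sub>-\<^sub>1\<close>, produces a factor
  \<open>2 m\<close>. One ends with the Gaussian integral if the degrees agree and with the derivative of a
  constant otherwise.\<close>

lemma hermite_poly_orthogonal:
  "(LINT x|lborel. poly (hermite_poly m * hermite_poly n) x * exp (- x\<^sup>2)) =
    (if m = n then 2 ^ n * fact n * sqrt pi else 0)"
proof (induction n arbitrary: m)
  case 0
  show ?case
  proof (cases m)
    case 0
    then show ?thesis by (simp add: integral_gauss)
  next
    case (Suc k)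
    then show ?thesis
      using hermite_pairing_Suc[of 0 k] by (simp add: mult.commute del: hermite_poly.simps(2))
  qed
next
  case (Suc n)
  show ?case
  proof (cases m)
    case 0
    then show ?thesis
      using hermite_pairing_Suc[of 0 n] by (simp del: hermite_poly.simps(2))
  next
    case (Suc k)
    have "(LINT x|lborel. poly (hermite_poly m * hermite_poly (Suc n)) x * exp (- x\<^sup>2)) =
        (LINT x|lborel. 2 * real (Suc k) * (poly (hermite_poly k * hermite_poly n) x * exp (- x\<^sup>2)))"
      unfolding hermite_pairing_Suc Suc pderiv_hermite_poly by (simp add: mult_ac)
    then show ?thesis
      using Suc.IH[of k] Suc by simp
  qed
qed

definition hermite_norm :: "nat \<Rightarrow> real" where
  "hermite_norm n = 1 / sqrt (2 ^ n * fact n * sqrt pi)"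

lemma hermite_fun_eq:
  "hermite_fun \<alpha> n t =
     sqrt \<alpha> * hermite_norm n * poly (hermite_poly n) (\<alpha> * t) * exp (- (\<alpha> * t)\<^sup>2 / 2)"
  by (simp add: hermite_fun_def hermite_norm_def hermite_H_eq_poly power_mult_distrib)

lemma hermite_norm_square: "(hermite_norm n)\<^sup>2 = 1 / (2 ^ n * fact n * sqrt pi)"
  by (simp add: hermite_norm_def power_divide)

lemma hermite_fun_mult:
  assumes "\<alpha> > 0"
  shows "hermite_fun \<alpha> m t * hermite_fun \<alpha> n t =
     \<alpha> * hermite_norm m * hermite_norm n * (poly (hermite_poly m * hermite_poly n) (\<alpha> * t) * exp (- (\<alpha> * t)\<^sup>2))"
proof -
  have e: "exp (- (\<alpha> * t)\<^sup>2 / 2) * exp (- (\<alpha> * t)\<^sup>2 / 2) = exp (- (\<alpha> * t)\<^sup>2)"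
    by (simp add: exp_add[symmetric])
  have "hermite_fun \<alpha> m t * hermite_fun \<alpha> n t =
     (sqrt \<alpha> * sqrt \<alpha>) * hermite_norm m * hermite_norm n * poly (hermite_poly m * hermite_poly n) (\<alpha> * t) *
     (exp (- (\<alpha> * t)\<^sup>2 / 2) * exp (- (\<alpha> * t)\<^sup>2 / 2))"
    unfolding hermite_fun_eq by (simp add: mult_ac del: real_sqrt_mult_self)
  then show ?thesis using assms unfolding e by (simp add: mult_ac)
qed

lemma hermite_fun_orthonormal:
  assumes "\<alpha> > 0"
  shows "has_bochner_integral lborel (\<lambda>t. hermite_fun \<alpha> m t * hermite_fun \<alpha> n t) (if m = n then 1 else 0)"
proof -
  let ?f = "\<lambda>x. poly (hermite_poly m * hermite_poly n) x * exp (- x\<^sup>2)"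
  have "has_bochner_integral lborel ?f (if m = n then 2 ^ n * fact n * sqrt pi else 0)"
    unfolding has_bochner_integral_iff
    by (intro conjI integrable_poly_gauss hermite_poly_orthogonal)
  then have "has_bochner_integral lborel (\<lambda>t. ?f (0 + \<alpha> * t))
      ((if m = n then 2 ^ n * fact n * sqrt pi else 0) /\<^sub>R \<bar>\<alpha>\<bar>)"
    using assms by (intro lborel_has_bochner_integral_real_affine_iff[THEN iffD1]) auto
  then have "has_bochner_integral lborel (\<lambda>t. \<alpha> * hermite_norm m * hermite_norm n * ?f (0 + \<alpha> * t))
      (\<alpha> * hermite_norm m * hermite_norm n * ((if m = n then 2 ^ n * fact n * sqrt pi else 0) /\<^sub>R \<bar>\<alpha>\<bar>))"
    by (intro has_bochner_integral_mult_right)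
  moreover have "\<alpha> * hermite_norm m * hermite_norm n * ((if m = n then 2 ^ n * fact n * sqrt pi else 0) /\<^sub>R \<bar>\<alpha>\<bar>)
      = (if m = n then 1 else 0)"
    using assms hermite_norm_square[of n] by (auto simp: power2_eq_square field_simps)
  ultimately show ?thesis
    unfolding hermite_fun_mult[OF assms] by simp
qed

text \<open>Hermite's equation \<open>H'' - 2 x H' + 2 n H = 0\<close>, from the recursion and the rule
  \<open>H\<^sub>n' = 2 n H\<^sub>n\<^sub>-\<^sub>1\<close>.\<close>

lemma hermite_poly_ode:
  "pderiv (pderiv (hermite_poly n)) = [:0, 2:] * pderiv (hermite_poly n) - smult (2 * real n) (hermite_poly n)"
proof (cases n)
  case (Suc k)
  have "pderiv (hermite_poly k) = [:0, 2:] * hermite_poly k - hermite_poly (Suc k)" by simp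
  then show ?thesis
    unfolding Suc pderiv_hermite_poly pderiv_smult
    by (simp only: smult_diff_right mult_smult_right)
qed simp

text \<open>At 0 the three-term recurrence links degrees of the same parity only, and after normalization
  the step from \<open>n\<close> to \<open>n + 2\<close> multiplies the square by \<open>(n + 1) / (n + 2)\<close>.\<close>

lemma hermite_at_0_le: "(hermite_norm n * poly (hermite_poly n) 0)\<^sup>2 \<le> 1 / sqrt pi"
proof (induction n rule: induct_nat_012)
  case (ge2 n)
  have "poly (hermite_poly (Suc (Suc n))) 0 = - poly (pderiv (hermite_poly (Suc n))) 0"
    by (simp add: hermite_poly.simps(2)[of "Suc n"] del: hermite_poly.simps(2))
  also have "\<dots> = - (2 * real (Suc n)) * poly (hermite_poly n) 0"
    unfolding pderiv_hermite_poly by (simp add: algebra_simps)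
  finally have h: "poly (hermite_poly (Suc (Suc n))) 0 = - (2 * real (Suc n)) * poly (hermite_poly n) 0" .
  have "(hermite_norm (Suc (Suc n)) * poly (hermite_poly (Suc (Suc n))) 0)\<^sup>2 =
      (real (Suc n) / real (Suc (Suc n))) * (hermite_norm n * poly (hermite_poly n) 0)\<^sup>2"
    unfolding h power_mult_distrib hermite_norm_square
    by (simp add: divide_simps del: of_nat_Suc) (simp add: power2_eq_square algebra_simps)
  also have "\<dots> \<le> 1 * (hermite_norm n * poly (hermite_poly n) 0)\<^sup>2"
    by (intro mult_right_mono) auto
  finally show ?case using ge2 by simp
qed (simp_all add: power_mult_distrib hermite_norm_square)

lemma hermite_deriv_at_0_le:
  "(hermite_norm n * poly (pderiv (hermite_poly n)) 0)\<^sup>2 \<le> 2 * real n / sqrt pi"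
proof (cases n)
  case (Suc k)
  have "(hermite_norm n * poly (pderiv (hermite_poly n)) 0)\<^sup>2 =
      2 * real n * (hermite_norm k * poly (hermite_poly k) 0)\<^sup>2"
    unfolding Suc pderiv_hermite_poly power_mult_distrib hermite_norm_square
    by (simp add: divide_simps power_mult_distrib del: of_nat_Suc)
      (simp add: power2_eq_square algebra_simps)
  also have "\<dots> \<le> 2 * real n * (1 / sqrt pi)"
    by (intro mult_left_mono hermite_at_0_le) simp
  finally show ?thesis by simp
qed simp

text \<open>With \<open>v'' = (x\<^sup>2 - 2n - 1) v\<close> the derivative of the left-hand side collapses to \<open>- 2 x v\<^sup>2\<close>:
  it increases on the negative axis and decreases on the positive one.\<close>

lemma hermite_energy_le:
  fixes n :: nat
  defines "v \<equiv> (\<lambda>x. poly (hermite_poly n) x * exp (- x\<^sup>2 / 2))"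
    and "v' \<equiv> (\<lambda>x. poly (pderiv (hermite_poly n) - [:0, 1:] * hermite_poly n) x * exp (- x\<^sup>2 / 2))"
  shows "(v' x)\<^sup>2 + (2 * real n + 1 - x\<^sup>2) * (v x)\<^sup>2 \<le> (v' 0)\<^sup>2 + (2 * real n + 1) * (v 0)\<^sup>2"
proof -
  have dv: "(v has_real_derivative v' x) (at x)" for x
    unfolding v_def v'_def
    by (auto intro!: derivative_eq_intros poly_DERIV simp: algebra_simps)
  have dv': "(v' has_real_derivative (x\<^sup>2 - (2 * real n + 1)) * v x) (at x)" for x
  proof -
    have ode: "poly (pderiv (pderiv (hermite_poly n))) x =
        2 * x * poly (pderiv (hermite_poly n)) x - 2 * real n * poly (hermite_poly n) x"
      unfolding hermite_poly_ode by simp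
    show ?thesis
      unfolding v_def v'_def
      by (auto intro!: derivative_eq_intros poly_DERIV
          simp: ode pderiv_diff pderiv_mult pderiv_pCons algebra_simps power2_eq_square)
  qed
  define E where "E x = (v' x)\<^sup>2 + (2 * real n + 1 - x\<^sup>2) * (v x)\<^sup>2" for x
  have dE: "(E has_real_derivative - 2 * x * (v x)\<^sup>2) (at x)" for x
    unfolding E_def
    by (auto intro!: derivative_eq_intros dv dv' simp: algebra_simps power2_eq_square)
  have "E x \<le> E 0"
  proof (cases "x \<ge> 0")
    case True
    then show ?thesis
      by (rule DERIV_nonpos_imp_nonincreasing)
        (use dE in \<open>force simp: mult_nonneg_nonneg\<close>)
  next
    case False
    then have "x \<le> 0" by simp
    then show ?thesis
      by (rule DERIV_nonneg_imp_nondecreasing)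
        (use dE in \<open>force simp: mult_nonpos_nonneg\<close>)
  qed
  then show ?thesis by (simp add: E_def)
qed

text \<open>For \<open>n\<close> beyond the squared argument the coefficient \<open>2n + 1 - y\<^sup>2\<close> in the energy is at least
  \<open>n + 1\<close>, while the energy of the normalized function at 0 is at most \<open>(4n + 1) / sqrt pi\<close>. Both grow linearly in \<open>n\<close>, which
  leaves a bound independent of \<open>n\<close>.\<close>

lemma hermite_fun_square_le:
  assumes "\<alpha> > 0" "(\<alpha> * t)\<^sup>2 \<le> real n"
  shows "(hermite_fun \<alpha> n t)\<^sup>2 \<le> 4 * \<alpha> / sqrt pi"
proof -
  define y v where "y = \<alpha> * t" and "v = poly (hermite_poly n) y * exp (- y\<^sup>2 / 2)"
  have "(2 * real n + 1 - y\<^sup>2) * v\<^sup>2 \<le>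
      (poly (pderiv (hermite_poly n) - [:0, 1:] * hermite_poly n) y * exp (- y\<^sup>2 / 2))\<^sup>2 +
      (2 * real n + 1 - y\<^sup>2) * v\<^sup>2"
    by simp
  also have "\<dots> \<le> (poly (pderiv (hermite_poly n)) 0)\<^sup>2 + (2 * real n + 1) * (poly (hermite_poly n) 0)\<^sup>2"
    using hermite_energy_le[of n y] unfolding v_def by simp
  finally have "(2 * real n + 1 - y\<^sup>2) * v\<^sup>2 \<le>
      (poly (pderiv (hermite_poly n)) 0)\<^sup>2 + (2 * real n + 1) * (poly (hermite_poly n) 0)\<^sup>2" .
  moreover have "(real n + 1) * v\<^sup>2 \<le> (2 * real n + 1 - y\<^sup>2) * v\<^sup>2"
    using assms by (intro mult_right_mono) (auto simp: y_def)
  ultimately have "(real n + 1) * v\<^sup>2 \<le>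
      (poly (pderiv (hermite_poly n)) 0)\<^sup>2 + (2 * real n + 1) * (poly (hermite_poly n) 0)\<^sup>2"
    by linarith
  then have "(hermite_norm n)\<^sup>2 * ((real n + 1) * v\<^sup>2) \<le> (hermite_norm n)\<^sup>2 *
      ((poly (pderiv (hermite_poly n)) 0)\<^sup>2 + (2 * real n + 1) * (poly (hermite_poly n) 0)\<^sup>2)"
    by (rule mult_left_mono) simp
  also have "\<dots> = (hermite_norm n * poly (pderiv (hermite_poly n)) 0)\<^sup>2 +
      (2 * real n + 1) * (hermite_norm n * poly (hermite_poly n) 0)\<^sup>2"
    by (simp add: power_mult_distrib algebra_simps)
  also have "\<dots> \<le> 2 * real n / sqrt pi + (2 * real n + 1) * (1 / sqrt pi)"
    by (intro add_mono mult_left_mono hermite_at_0_le hermite_deriv_at_0_le) simp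
  also have "\<dots> = (4 * real n + 1) / sqrt pi"
    by (simp add: add_divide_distrib[symmetric])
  also have "\<dots> \<le> (real n + 1) * (4 / sqrt pi)"
    by (simp add: divide_simps)
  finally have "(real n + 1) * ((hermite_norm n)\<^sup>2 * v\<^sup>2) \<le> (real n + 1) * (4 / sqrt pi)"
    by (simp add: mult_ac)
  then have "(hermite_norm n)\<^sup>2 * v\<^sup>2 \<le> 4 / sqrt pi"
    by (subst (asm) mult_le_cancel_left_pos) auto
  then have "\<alpha> * ((hermite_norm n)\<^sup>2 * v\<^sup>2) \<le> \<alpha> * (4 / sqrt pi)"
    using assms by (intro mult_left_mono) auto
  moreover have "(hermite_fun \<alpha> n t)\<^sup>2 = \<alpha> * ((hermite_norm n)\<^sup>2 * v\<^sup>2)"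
    using assms by (simp add: hermite_fun_eq v_def y_def power_mult_distrib)
  ultimately show ?thesis by (simp add: mult_ac)
qed

section \<open>Transformed Hermite functions in the weighted space\<close>

lemma weight_nonneg: "x \<in> {0<..<1} \<Longrightarrow> weight x \<ge> 0"
  by (simp add: weight_def)

lemma AE_unit_measure: "(\<And>x. x \<in> {0<..<1} \<Longrightarrow> P x) \<Longrightarrow> AE x in unit_measure. P x"
  by (rule AE_I2) (simp add: space_restrict_space)

lemma borel_measurable_unit:
  "f \<in> borel_measurable borel \<Longrightarrow> f \<in> borel_measurable unit_measure"
  by (intro measurable_restrict_space1 measurable_completion) simp

lemma weight_measurable [measurable]: "weight \<in> borel_measurable unit_measure"
  by (rule borel_measurable_unit) (simp add: weight_def[abs_def])

lemma sets_weighted [simp, measurable_cong]: "sets weighted_measure = sets unit_measure"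
  by (simp add: weighted_measure_def)

lemma measurable_weighted_iff: "borel_measurable weighted_measure = borel_measurable unit_measure"
  by (rule measurable_cong_sets) auto

lemma integral_weighted:
  fixes f :: "real \<Rightarrow> real"
  assumes "f \<in> borel_measurable unit_measure"
  shows "integrable weighted_measure f \<longleftrightarrow> integrable unit_measure (\<lambda>x. f x * weight x)"
    and "(LINT x|weighted_measure. f x) = (LINT x|unit_measure. f x * weight x)"
proof -
  have nn: "AE x in unit_measure. 0 \<le> weight x"
    by (rule AE_unit_measure) (rule weight_nonneg)
  show "integrable weighted_measure f \<longleftrightarrow> integrable unit_measure (\<lambda>x. f x * weight x)"
    unfolding weighted_measure_def
    using integrable_density[OF assms weight_measurable nn] by (simp add: mult.commute)
  show "(LINT x|weighted_measure. f x) = (LINT x|unit_measure. f x * weight x)"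
    unfolding weighted_measure_def
    using integral_density[OF assms weight_measurable nn] by (simp add: mult.commute)
qed

lemma L2_weighted_times_sqrt:
  "f \<in> L2 weighted_measure \<Longrightarrow> (\<lambda>x. f x * sqrt (weight x)) \<in> L2 unit_measure"
proof -
  assume f: "f \<in> L2 weighted_measure"
  then have m[measurable]: "f \<in> borel_measurable unit_measure"
    by (simp add: L2_iff measurable_weighted_iff)
  have "integrable unit_measure (\<lambda>x. (f x)\<^sup>2 * weight x)"
    using f by (simp add: L2_iff integral_weighted)
  then have "integrable unit_measure (\<lambda>x. (f x * sqrt (weight x))\<^sup>2)"
    by (rule integrable_cong_AE_imp)
      (auto intro!: AE_unit_measure simp: power_mult_distrib weight_nonneg)
  then show ?thesis by (simp add: L2_iff)
qed

text \<open>The derivative of \<open>logit\<close> is \<open>weight\<close>, and \<open>logit\<close> maps the unit interval bijectively onto the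
  line: the weighted measure is Lebesgue measure in the coordinate \<open>logit x\<close>.\<close>

lemma logit_substitution:
  fixes f :: "real \<Rightarrow> real"
  assumes "has_bochner_integral lborel f I"
  shows "has_bochner_integral weighted_measure (\<lambda>x. f (logit x)) I"
proof -
  have f[measurable]: "f \<in> borel_measurable borel" using assms by (auto simp: has_bochner_integral_iff)
  have logit_meas [measurable]: "logit \<in> borel_measurable borel"
    unfolding logit_def[abs_def] by measurable
  have meas: "(\<lambda>x. f (logit x)) \<in> borel_measurable unit_measure"
    by (rule borel_measurable_unit) measurable
  have der: "(logit has_field_derivative weight x) (at x within {0<..<1})" if "x \<in> {0<..<1}" for x
  proof -
    have "((\<lambda>x. ln (x / (1 - x))) has_field_derivative weight x) (at x)"
      using that by (auto intro!: derivative_eq_intros simp: weight_def divide_simps)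

    then show ?thesis by (simp add: logit_def[abs_def] has_field_derivative_at_within)
  qed
  have inv: "logit (1 / (1 + exp (- y))) = y" for y
  proof -
    have "1 + exp (- y) > 0" by (simp add: add_pos_pos)
    then have "(1 / (1 + exp (- y))) / (1 - 1 / (1 + exp (- y))) = exp y"
      by (simp add: field_simps exp_minus)
    then show ?thesis by (simp only: logit_def ln_exp)
  qed
  have image: "logit ` {0<..<1} = UNIV"
  proof (intro equalityI subset_UNIV subsetI)
    fix y :: real
    have "1 / (1 + exp (- y)) \<in> {0<..<1}" by (auto simp: divide_simps add_pos_pos)
    then show "y \<in> logit ` {0<..<1}" using inv[of y] by (metis imageI)
  qed
  have inj: "inj_on logit {0<..<1}"
  proof (rule inj_onI)
    fix x y :: real assume "x \<in> {0<..<1}" "y \<in> {0<..<1}" "logit x = logit y"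
    then have "0 < x / (1 - x)" "0 < y / (1 - y)" "ln (x / (1 - x)) = ln (y / (1 - y))"
      by (simp_all add: logit_def)
    then have "x / (1 - x) = y / (1 - y)" by (simp only: ln_inj_iff)
    then show "x = y"
      using \<open>x \<in> {0<..<1}\<close> \<open>y \<in> {0<..<1}\<close> by (simp add: frac_eq_eq algebra_simps)
  qed
  have f_int: "integrable lebesgue f" "integral\<^sup>L lebesgue f = I"
    using assms by (auto simp: has_bochner_integral_iff integrable_completion integral_completion)
  then have "f absolutely_integrable_on UNIV" "integral UNIV f = I"
    using lebesgue_integral_eq_integral[of UNIV f] by (auto simp: set_integrable_def lebesgue_on_UNIV_eq)
  then have *: "(\<lambda>x. \<bar>weight x\<bar> * f (logit x)) absolutely_integrable_on {0<..<1}"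
    "integral {0<..<1} (\<lambda>x. \<bar>weight x\<bar> * f (logit x)) = I"
    using has_absolute_integral_change_of_variables_1'[of "{0<..<1}" logit weight f I] der inj image
    by auto
  then have int: "integrable unit_measure (\<lambda>x. \<bar>weight x\<bar> * f (logit x))"
    by (simp add: set_integrable_def integrable_restrict_space)
  then have "(LINT x|unit_measure. \<bar>weight x\<bar> * f (logit x)) = I"
    using * by (subst lebesgue_integral_eq_integral) auto
  moreover have "integrable unit_measure (\<lambda>x. \<bar>weight x\<bar> * f (logit x)) \<longleftrightarrow>
      integrable unit_measure (\<lambda>x. f (logit x) * weight x)"
    by (rule Bochner_Integration.integrable_cong)
      (auto simp: space_restrict_space weight_nonneg mult.commute)
  moreover have "(LINT x|unit_measure. \<bar>weight x\<bar> * f (logit x)) =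
      (LINT x|unit_measure. f (logit x) * weight x)"
    by (rule Bochner_Integration.integral_cong)
      (auto simp: space_restrict_space weight_nonneg mult.commute)
  ultimately show ?thesis
    using int by (simp add: has_bochner_integral_iff integral_weighted[OF meas])
qed

lemma thermite_orthonormal:
  assumes "\<alpha> > 0"
  shows "has_bochner_integral weighted_measure (\<lambda>x. thermite_fun \<alpha> i x * thermite_fun \<alpha> j x) (if i = j then 1 else 0)"
  unfolding thermite_fun_def
  by (rule logit_substitution) (rule hermite_fun_orthonormal[OF assms])

lemma thermite_fun_L2:
  assumes "\<alpha> > 0"
  shows "thermite_fun \<alpha> n \<in> L2 weighted_measure"
proof -
  have "hermite_fun \<alpha> n \<in> borel_measurable borel"
    unfolding hermite_fun_eq[abs_def]
    by (intro borel_measurable_continuous_onI continuous_intros) auto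
  then have "(\<lambda>x. hermite_fun \<alpha> n (logit x)) \<in> borel_measurable borel"
    by (rule measurable_compose[rotated]) (simp add: logit_def[abs_def])
  then have "thermite_fun \<alpha> n \<in> borel_measurable weighted_measure"
    unfolding thermite_fun_def[abs_def] measurable_weighted_iff by (rule borel_measurable_unit)
  then show ?thesis
    using thermite_orthonormal[OF assms, of n n]
    by (simp add: L2_iff has_bochner_integral_iff power2_eq_square)
qed

text \<open>Bessel's inequality for the coefficients, and the uniform bound on the Hermite functions at the
  fixed point \<open>logit t\<close> for all indices \<open>k\<close> beyond \<open>(\<alpha> * logit t)\<^sup>2\<close>.\<close>

lemma summable_coefficients_thermite:
  assumes "\<alpha> > 0" "g \<in> L2 weighted_measure"
  shows "summable (\<lambda>k. ((LINT x|weighted_measure. thermite_fun \<alpha> k x * g x) * thermite_fun \<alpha> k t)\<^sup>2)"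
proof -
  define b where "b k = (LINT x|weighted_measure. thermite_fun \<alpha> k x * g x)" for k
  define C where "C = 4 * \<alpha> / sqrt pi"
  have "summable (\<lambda>k. (b k)\<^sup>2)"
    unfolding b_def using thermite_orthonormal[OF assms(1)] assms
    by (intro bessel_summable thermite_fun_L2) (simp_all add: has_bochner_integral_iff)
  then have sm: "summable (\<lambda>k. C * (b k)\<^sup>2)" by (rule summable_mult)
  obtain K where K: "(\<alpha> * logit t)\<^sup>2 \<le> real K"
    using real_arch_simple[of "(\<alpha> * logit t)\<^sup>2"] by blast
  have bound: "norm ((b k * thermite_fun \<alpha> k t)\<^sup>2) \<le> C * (b k)\<^sup>2" if "k \<ge> K" for k
  proof -
    have "(\<alpha> * logit t)\<^sup>2 \<le> real k" using K that by simp
    then have "(hermite_fun \<alpha> k (logit t))\<^sup>2 * (b k)\<^sup>2 \<le> C * (b k)\<^sup>2"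
      unfolding C_def by (intro mult_right_mono hermite_fun_square_le assms) auto
    then show ?thesis by (simp add: thermite_fun_def power_mult_distrib mult.commute)
  qed
  have "summable (\<lambda>k. (b k * thermite_fun \<alpha> k t)\<^sup>2)"
    by (rule summable_comparison_test[OF _ sm]) (use bound in blast)
  then show ?thesis by (simp only: b_def)
qed

section \<open>Step functions are dense in the unweighted space\<close>

lemma measure_unit_interval:
  assumes "0 \<le> r" "r \<le> 1"
  shows "measure unit_measure ({0<..r} \<inter> {0<..<1}) = r"
proof -
  have "measure unit_measure ({0<..r} \<inter> {0<..<1}) = measure lebesgue ({0<..r} \<inter> {0<..<1})"
    by (rule measure_restrict_space) auto
  also have "\<dots> = r"
  proof -
    have "{0<..r} \<inter> {0<..<1} = (if r = 1 then {0<..<1} else {0<..r})"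
      using assms by auto
    then show ?thesis using assms by simp
  qed
  finally show ?thesis .
qed

lemma finite_measure_unit: "finite_measure unit_measure"
  by (rule finite_measureI) (simp add: space_restrict_space emeasure_restrict_space)

lemma L2_unit_bounded:
  assumes "f \<in> borel_measurable unit_measure" "\<And>x. \<bar>f x\<bar> \<le> K"
  shows "f \<in> L2 unit_measure"
proof -
  interpret finite_measure unit_measure by (rule finite_measure_unit)
  have "integrable unit_measure (\<lambda>x. (f x)\<^sup>2)"
  proof (rule integrable_const_bound[where B = "K\<^sup>2"])
    show "AE x in unit_measure. norm ((f x)\<^sup>2) \<le> K\<^sup>2"
      using power_mono[OF assms(2) abs_ge_zero, of _ 2] by (intro AE_I2) simp
    show "(\<lambda>x. (f x)\<^sup>2) \<in> borel_measurable unit_measure"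
      by (intro borel_measurable_power assms(1))
  qed
  then show ?thesis using assms by (simp add: L2_iff)
qed

lemma indicator_L2_unit: "(indicator {p<..q} :: real \<Rightarrow> real) \<in> L2 unit_measure"
proof (rule L2_unit_bounded[where K = 1])
  show "(indicator {p<..q} :: real \<Rightarrow> real) \<in> borel_measurable unit_measure"
    by (rule borel_measurable_unit) simp
  show "\<bar>indicator {p<..q} x :: real\<bar> \<le> 1" for x :: real
    by (simp add: indicator_def)
qed

text \<open>The counterpart, on the side of the integrands, of the covariance of Brownian motion.\<close>

lemma inner_indicator_unit:
  assumes "0 \<le> s" "s \<le> 1" "0 \<le> t" "t \<le> 1"
  shows "(LINT x|unit_measure. indicator {0<..s} x * indicator {0<..t} x) = min s t"
proof -
  have "(LINT x|unit_measure. indicator {0<..s} x * indicator {0<..t} x :: real) =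
      (LINT x|unit_measure. indicator ({0<..min s t} \<inter> {0<..<1}) x)"
    by (rule Bochner_Integration.integral_cong) (auto simp: indicator_def space_restrict_space)
  also have "\<dots> = measure unit_measure (({0<..min s t} \<inter> {0<..<1}) \<inter> space unit_measure)"
    by (rule Bochner_Integration.integral_indicator)
  also have "({0<..min s t} \<inter> {0<..<1}) \<inter> space unit_measure = {0<..min s t} \<inter> {0<..<1}"
    by (auto simp: space_restrict_space)
  also have "measure unit_measure \<dots> = min s t"
    using assms by (intro measure_unit_interval) auto
  finally show ?thesis .
qed

text \<open>The cells are half-open on the left to match elementary integrals.\<close>

definition grid_step :: "nat \<Rightarrow> (real \<Rightarrow> real) \<Rightarrow> real \<Rightarrow> real" where
  "grid_step m h s = (\<Sum>i<m. h (real i / real m) * indicator {real i / real m<..real (Suc i) / real m} s)"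

lemma elementary_integral_grid_step:
  assumes "m > 0"
  shows "\<exists>X. elementary_integral W (grid_step m h) X"
  unfolding elementary_integral_def grid_step_def[abs_def]
proof (intro exI conjI)
  show "(0::real) \<le> real 0 / real m" "real m / real m \<le> 1" by simp_all
  show "\<forall>i<m. real i / real m < real (Suc i) / real m"
    using assms by (auto intro!: divide_strict_right_mono)
qed (rule refl)+

text \<open>A point of the unit interval lies in exactly one cell, whose index is read off from the ceiling
  of \<open>m * s\<close>.\<close>

lemma grid_step_eq:
  assumes "s \<in> {0<..<1}" "m > 0"
  obtains i where "i < m" "\<bar>real i / real m - s\<bar> \<le> 1 / real m" "grid_step m h s = h (real i / real m)"
proof -
  define i where "i = nat (\<lceil>real m * s\<rceil> - 1)"
  have "real m * s > 0" "real m * s < real m" using assms by simp_all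
  then have "0 < \<lceil>real m * s\<rceil>" "\<lceil>real m * s\<rceil> \<le> int m"
    unfolding zero_less_ceiling ceiling_le_iff of_int_of_nat_eq by linarith+
  then have i: "\<lceil>real m * s\<rceil> = int i + 1" and "i < m" unfolding i_def by linarith+
  have mem: "s \<in> {real j / real m<..real (Suc j) / real m} \<longleftrightarrow> j = i" for j
  proof -
    have "s \<in> {real j / real m<..real (Suc j) / real m} \<longleftrightarrow> real j < real m * s \<and> real m * s \<le> real j + 1"
      using assms(2) by (simp add: field_simps)
    also have "\<dots> \<longleftrightarrow> \<lceil>real m * s\<rceil> = int j + 1" by (simp add: ceiling_eq_iff)
    finally show ?thesis using i by auto
  qed
  have "grid_step m h s = (\<Sum>j<m. if j = i then h (real j / real m) else 0)"
    unfolding grid_step_def by (intro sum.cong refl) (simp add: indicator_def mem del: of_nat_Suc greaterThanAtMost_iff)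
  also have "\<dots> = h (real i / real m)" using \<open>i < m\<close> by simp
  finally have "grid_step m h s = h (real i / real m)" .
  moreover have "\<bar>real i / real m - s\<bar> \<le> 1 / real m"
    using mem[of i] by (simp add: add_divide_distrib)
  ultimately show thesis using \<open>i < m\<close> that by blast
qed

lemma grid_step_tendsto:
  assumes "isCont h s" "s \<in> {0<..<1}"
  shows "(\<lambda>n. grid_step (Suc n) h s) \<longlonglongrightarrow> h s"
proof -
  have "\<exists>y. \<bar>y - s\<bar> \<le> 1 / real (Suc n) \<and> grid_step (Suc n) h s = h y" for n
    using grid_step_eq[OF assms(2), of "Suc n" h] by (metis zero_less_Suc)
  then obtain y where y: "\<And>n. \<bar>y n - s\<bar> \<le> 1 / real (Suc n)" "\<And>n. grid_step (Suc n) h s = h (y n)"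
    by metis
  have "(\<lambda>n. y n - s) \<longlonglongrightarrow> 0"
    by (rule Lim_null_comparison[OF _ LIMSEQ_Suc[OF lim_1_over_n]])
      (use y(1) in \<open>auto intro!: always_eventually\<close>)
  then have "y \<longlonglongrightarrow> s" by (simp add: LIM_zero_iff)
  then show ?thesis
    unfolding y(2) by (rule isCont_tendsto_compose[OF assms(1)])
qed

definition clip :: "real \<Rightarrow> real \<Rightarrow> real" where
  "clip K x = max (- K) (min K x)"

lemma abs_clip_le: "K \<ge> 0 \<Longrightarrow> \<bar>clip K x\<bar> \<le> K"
  by (auto simp: clip_def)

lemma continuous_clip: "continuous_on UNIV (clip K)"
  unfolding clip_def[abs_def] by (intro continuous_intros)

lemma clip_measurable [measurable]: "clip K \<in> borel_measurable borel"
  by (rule borel_measurable_continuous_onI[OF continuous_clip])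

lemma abs_diff_clip_le: "K \<ge> 0 \<Longrightarrow> \<bar>clip K x - x\<bar> \<le> \<bar>x\<bar>"
  by (auto simp: clip_def)

lemma tendsto_0_less:
  fixes X :: "nat \<Rightarrow> real"
  assumes "X \<longlonglongrightarrow> 0" "e > 0"
  shows "\<exists>n. X n < e"
  using order_tendstoD(2)[OF assms] by (auto simp: eventually_sequentially)

text \<open>Three approximations in a row. Clipping \<open>f\<close> at a high level changes little; the clipped function
  is an almost everywhere limit of continuous functions, which may be clipped at the same level;
  a continuous function is the pointwise limit of its grid steps. Each limit is dominated, by
  \<open>f\<^sup>2\<close> in the first case and by a constant in the other two.\<close>

lemma L2_grid_step_dense:
  assumes f: "f \<in> L2 unit_measure" and "e > 0"
  shows "\<exists>m>0. \<exists>h. (LINT x|unit_measure. (grid_step m h x - f x)\<^sup>2) < e"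
proof -
  interpret finite_measure unit_measure by (rule finite_measure_unit)
  have fm: "f \<in> borel_measurable unit_measure" using f by (rule L2_measurable)
  have clip_m: "(\<lambda>x. clip K (f x)) \<in> borel_measurable unit_measure" for K
    using fm by measurable
  have "(\<lambda>n. LINT x|unit_measure. (clip (real n) (f x) - f x)\<^sup>2) \<longlonglongrightarrow> 0"
  proof (rule L2_dominated_convergence[where w = "\<lambda>x. (f x)\<^sup>2"])
    show "AE x in unit_measure. (\<lambda>n. clip (real n) (f x)) \<longlonglongrightarrow> f x"
    proof (rule AE_I2)
      fix x
      obtain n where "\<bar>f x\<bar> \<le> real n" using real_arch_simple by blast
      then have "\<forall>k\<ge>n. clip (real k) (f x) = f x" by (auto simp: clip_def)
      then show "(\<lambda>n. clip (real n) (f x)) \<longlonglongrightarrow> f x"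
        by (intro tendsto_eventually) (auto simp: eventually_sequentially)
    qed
    show "AE x in unit_measure. (clip (real n) (f x) - f x)\<^sup>2 \<le> (f x)\<^sup>2" for n
      using abs_diff_clip_le[of "real n"] by (intro AE_I2) (simp add: abs_le_square_iff[symmetric])
    show "integrable unit_measure (\<lambda>x. (f x)\<^sup>2)" using f by (rule L2_integrable_square)
  qed (rule clip_m fm)+
  then obtain n where n: "(LINT x|unit_measure. (clip (real n) (f x) - f x)\<^sup>2) < e / 4"
    using tendsto_0_less[of _ "e / 4"] \<open>e > 0\<close> by fastforce
  define K where "K = real n"
  have "K \<ge> 0" by (simp add: K_def)
  define f' where "f' x = clip K (f x)" for x
  have f'm: "f' \<in> borel_measurable unit_measure" unfolding f'_def[abs_def] by (rule clip_m)
  have f'b: "\<bar>f' x\<bar> \<le> K" for x unfolding f'_def by (rule abs_clip_le[OF \<open>K \<ge> 0\<close>])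
  have f': "f' \<in> L2 unit_measure" by (rule L2_unit_bounded[OF f'm f'b])
  have bdd: "(a - b)\<^sup>2 \<le> (2 * K)\<^sup>2" if "\<bar>a\<bar> \<le> K" "\<bar>b\<bar> \<le> K" for a b :: real
    using that by (subst abs_le_square_iff[symmetric]) auto
  have const: "integrable unit_measure (\<lambda>x. (2 * K)\<^sup>2)" by simp

  have "f measurable_on {0<..<1}"
    using fm by (subst measurable_on_iff_borel_measurable) auto
  then obtain Z g where Z: "negligible Z" and g: "\<And>n. continuous_on UNIV (g n)"
    and lim: "\<And>x. x \<notin> Z \<Longrightarrow> (\<lambda>n. g n x) \<longlonglongrightarrow> (if x \<in> {0<..<1} then f x else 0)"
    unfolding measurable_on_def by blast
  define g' where "g' k x = clip K (g k x)" for k x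
  have g'c: "continuous_on UNIV (g' k)" for k
    unfolding g'_def[abs_def]
    by (rule continuous_on_compose2[OF continuous_clip g]) simp
  have g'm: "g' k \<in> borel_measurable unit_measure" for k
    by (rule borel_measurable_unit[OF borel_measurable_continuous_onI[OF g'c]])
  have g'b: "\<bar>g' k x\<bar> \<le> K" for k x unfolding g'_def by (rule abs_clip_le[OF \<open>K \<ge> 0\<close>])
  have g': "g' k \<in> L2 unit_measure" for k by (rule L2_unit_bounded[OF g'm g'b])
  have "(\<lambda>k. LINT x|unit_measure. (g' k x - f' x)\<^sup>2) \<longlonglongrightarrow> 0"
  proof (rule L2_dominated_convergence[OF g'm f'm const])
    show "AE x in unit_measure. (g' k x - f' x)\<^sup>2 \<le> (2 * K)\<^sup>2" for k
      by (intro AE_I2 bdd g'b f'b)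
    have "AE x in lebesgue. x \<notin> Z"
      using Z by (intro AE_not_in) (simp add: negligible_iff_null_sets)
    then have "AE x in unit_measure. x \<notin> Z"
      by (subst AE_restrict_space_iff) auto
    moreover have "AE x in unit_measure. x \<in> {0<..<1}"
      by (rule AE_unit_measure)
    ultimately show "AE x in unit_measure. (\<lambda>k. g' k x) \<longlonglongrightarrow> f' x"
    proof eventually_elim
      case (elim x)
      then have "(\<lambda>k. g k x) \<longlonglongrightarrow> f x" using lim[of x] by simp
      then show ?case
        unfolding g'_def f'_def
        by (rule continuous_on_tendsto_compose[OF continuous_clip]) auto
    qed
  qed
  then obtain k where k: "(LINT x|unit_measure. (g' k x - f' x)\<^sup>2) < e / 16"
    using tendsto_0_less[of _ "e / 16"] \<open>e > 0\<close> by fastforce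

  define s where "s j = grid_step (Suc j) (g' k)" for j
  have sm: "s j \<in> borel_measurable unit_measure" for j
    unfolding s_def grid_step_def[abs_def]
    by (intro borel_measurable_sum borel_measurable_times borel_measurable_const
        L2_measurable[OF indicator_L2_unit])
  have s: "s j \<in> L2 unit_measure" for j
    unfolding s_def grid_step_def[abs_def] by (intro L2_sum L2_cmult indicator_L2_unit)
  have sb: "\<bar>s j x\<bar> \<le> K" if "x \<in> {0<..<1}" for j x
    using grid_step_eq[OF that, of "Suc j" "g' k"] g'b unfolding s_def by (metis zero_less_Suc)
  have "(\<lambda>j. LINT x|unit_measure. (s j x - g' k x)\<^sup>2) \<longlonglongrightarrow> 0"
  proof (rule L2_dominated_convergence[OF sm g'm const])
    show "AE x in unit_measure. (s j x - g' k x)\<^sup>2 \<le> (2 * K)\<^sup>2" for j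
      by (rule AE_unit_measure) (intro bdd sb g'b)
    show "AE x in unit_measure. (\<lambda>j. s j x) \<longlonglongrightarrow> g' k x"
      unfolding s_def using g'c[of k]
      by (intro AE_unit_measure grid_step_tendsto) (auto simp: continuous_on_eq_continuous_at)
  qed
  then obtain j where j: "(LINT x|unit_measure. (s j x - g' k x)\<^sup>2) < e / 16"
    using tendsto_0_less[of _ "e / 16"] \<open>e > 0\<close> by fastforce

  have "(LINT x|unit_measure. (s j x - f' x)\<^sup>2) < e / 4"
    using integral_square_triangle[OF s g' f', of j k] j k by linarith
  then have "(LINT x|unit_measure. (s j x - f x)\<^sup>2) < e"
    using integral_square_triangle[OF s f' f, of j] n unfolding f'_def K_def by linarith
  then show ?thesis unfolding s_def by blast
qed

section \<open>Wiener integral as an isometry\<close>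

lemma partition_bounds:
  fixes \<tau> :: "nat \<Rightarrow> real"
  assumes "\<And>i. i < m \<Longrightarrow> \<tau> i < \<tau> (Suc i)" "i \<le> m"
  shows "\<tau> 0 \<le> \<tau> i" "\<tau> i \<le> \<tau> m"
proof -
  show "\<tau> 0 \<le> \<tau> i"
    using assms(2)
  proof (induction i)
    case (Suc i)
    then show ?case using assms(1)[of i] by simp
  qed simp
  show "\<tau> i \<le> \<tau> m"
    using assms(2)
  proof (induction rule: inc_induct)
    case (step i)
    then show ?case using assms(1)[of i] by simp
  qed simp
qed

lemma has_wiener_integral_L2:
  "has_wiener_integral M W f X \<Longrightarrow> f \<in> L2 unit_measure"
  "has_wiener_integral M W f X \<Longrightarrow> X \<in> L2 M"
  by (auto simp: has_wiener_integral_def L2_tendsto_def)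

context wiener_process
begin

lemma increment_moments:
  assumes "0 \<le> s" "s < t"
  shows "(\<lambda>\<omega>. W t \<omega> - W s \<omega>) \<in> L2 M" "integrable M (\<lambda>\<omega>. W t \<omega> - W s \<omega>)"
    "(LINT \<omega>|M. W t \<omega> - W s \<omega>) = 0" "(LINT \<omega>|M. (W t \<omega> - W s \<omega>)\<^sup>2) = c\<^sup>2 * (t - s)"
proof -
  let ?X = "\<lambda>\<omega>. W t \<omega> - W s \<omega>" and ?\<sigma> = "c * sqrt (t - s)"
  have \<sigma>: "?\<sigma> > 0" using assms c_pos by simp
  have D: "distributed M lborel ?X (normal_density 0 ?\<sigma>)" by (rule normal_increments[OF assms])
  have meas: "?X \<in> borel_measurable M"
    using assms by (intro borel_measurable_diff measurable_W) auto
  have int: "integrable M (\<lambda>\<omega>. ?X \<omega> ^ k)" for k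
    using distributed_integrable[OF D, of "\<lambda>x. x ^ k"] integrable_normal_moment[OF \<sigma>, of 0 k] by simp
  have eq: "(LINT \<omega>|M. ?X \<omega> ^ k) = (LINT x|lborel. normal_density 0 ?\<sigma> x * (x - 0) ^ k)" for k
    using distributed_integral[OF D, of "\<lambda>x. x ^ k"] by simp
  show "?X \<in> L2 M" using int[of 2] meas by (simp add: L2_iff)
  show "integrable M ?X" using int[of 1] by simp
  show "(LINT \<omega>|M. ?X \<omega>) = 0"
    using eq[of 1] integral_normal_moment_odd[OF \<sigma>, of 0 0] by simp
  have "(LINT \<omega>|M. (?X \<omega>)\<^sup>2) = ?\<sigma>\<^sup>2"
    using eq[of 2] integral_normal_moment_even[OF \<sigma>, of 0 1] by simp
  also have "\<dots> = c\<^sup>2 * (t - s)" using assms by (simp add: power_mult_distrib)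
  finally show "(LINT \<omega>|M. (?X \<omega>)\<^sup>2) = c\<^sup>2 * (t - s)" .
qed

lemma L2_from_origin: "t \<ge> 0 \<Longrightarrow> (\<lambda>\<omega>. W t \<omega> - W 0 \<omega>) \<in> L2 M"
  using increment_moments(1)[of 0 t] by (cases "t = 0") (auto simp: L2_iff)

lemma consecutive_increments_uncorrelated:
  assumes "0 \<le> r" "r < s" "s < t"
  shows "(LINT \<omega>|M. (W s \<omega> - W r \<omega>) * (W t \<omega> - W s \<omega>)) = 0"
proof -
  \<comment> \<open>Only the first three nodes of the partition matter.\<close>
  define \<tau> where "\<tau> i = (if i = 0 then r else if i = 1 then s else t)" for i :: nat
  have "indep_vars (\<lambda>_. borel) (\<lambda>i \<omega>. W (\<tau> (Suc i)) \<omega> - W (\<tau> i) \<omega>) {..<2}"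
    using assms by (intro indep_increments) (auto simp: \<tau>_def less_2_cases_iff)
  moreover have "integrable M (\<lambda>\<omega>. W (\<tau> (Suc i)) \<omega> - W (\<tau> i) \<omega>)" if "i \<in> {..<2}" for i
    using that assms increment_moments(2)[of r s] increment_moments(2)[of s t]
    by (auto simp: \<tau>_def less_2_cases_iff)
  ultimately have "(LINT \<omega>|M. (\<Prod>i<2. W (\<tau> (Suc i)) \<omega> - W (\<tau> i) \<omega>)) =
      (\<Prod>i<2. (LINT \<omega>|M. W (\<tau> (Suc i)) \<omega> - W (\<tau> i) \<omega>))"
    by (intro indep_vars_lebesgue_integral) auto
  then show ?thesis
    using increment_moments(3)[of r s] assms
    by (simp add: \<tau>_def numeral_2_eq_2)
qed

text \<open>Write the later value as the earlier one plus an increment that is uncorrelated with it.\<close>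

lemma covariance_from_origin:
  assumes "0 \<le> s" "s \<le> t"
  shows "(LINT \<omega>|M. (W s \<omega> - W 0 \<omega>) * (W t \<omega> - W 0 \<omega>)) = c\<^sup>2 * s"
proof (cases "0 < s \<and> s < t")
  case True
  have L2: "(\<lambda>\<omega>. W s \<omega> - W 0 \<omega>) \<in> L2 M" "(\<lambda>\<omega>. W t \<omega> - W s \<omega>) \<in> L2 M"
    using True increment_moments(1) by auto
  have "(LINT \<omega>|M. (W s \<omega> - W 0 \<omega>) * (W t \<omega> - W 0 \<omega>)) =
      (LINT \<omega>|M. (W s \<omega> - W 0 \<omega>)\<^sup>2 + (W s \<omega> - W 0 \<omega>) * (W t \<omega> - W s \<omega>))"
    by (simp add: power2_eq_square algebra_simps)
  also have "\<dots> = (LINT \<omega>|M. (W s \<omega> - W 0 \<omega>)\<^sup>2) + (LINT \<omega>|M. (W s \<omega> - W 0 \<omega>) * (W t \<omega> - W s \<omega>))"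
    using L2 by (intro Bochner_Integration.integral_add L2_integrable_square L2_integrable_mult)
  also have "\<dots> = c\<^sup>2 * s"
    using True increment_moments(4)[of 0 s] consecutive_increments_uncorrelated[of 0 s t] by simp
  finally show ?thesis .
next
  case False
  then show ?thesis
    using assms increment_moments(4)[of 0 s] by (cases "s = 0") (auto simp: power2_eq_square)
qed

lemma covariance_from_origin_min:
  assumes "0 \<le> s" "0 \<le> t"
  shows "(LINT \<omega>|M. (W s \<omega> - W 0 \<omega>) * (W t \<omega> - W 0 \<omega>)) = c\<^sup>2 * min s t"
proof (cases "s \<le> t")
  case False
  then show ?thesis
    using covariance_from_origin[of t s] assms by (simp add: mult.commute min_def)
qed (use covariance_from_origin assms in simp)

text \<open>Both sides are bilinear, and an increment is a difference of increments from 0 just as the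
  indicator of \<open>{p<..q}\<close> is a difference of indicators of intervals that start at 0. So the two
  computations of \<open>min s t\<close> suffice, however the two intervals overlap.\<close>

lemma increment_covariance:
  assumes "0 \<le> p" "p \<le> q" "q \<le> 1" "0 \<le> r" "r \<le> s" "s \<le> 1"
  shows "(LINT \<omega>|M. (W q \<omega> - W p \<omega>) * (W s \<omega> - W r \<omega>)) =
    c\<^sup>2 * (LINT x|unit_measure. indicator {p<..q} x * indicator {r<..s} x)"
proof -
  let ?V = "\<lambda>t \<omega>. W t \<omega> - W 0 \<omega>" and ?\<iota> = "\<lambda>t. indicator {0<..t} :: real \<Rightarrow> real"
  have "(LINT \<omega>|M. (W q \<omega> - W p \<omega>) * (W s \<omega> - W r \<omega>)) =
      (LINT \<omega>|M. (?V q \<omega> - ?V p \<omega>) * (?V s \<omega> - ?V r \<omega>))" by simp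
  also have "\<dots> = (LINT \<omega>|M. ?V q \<omega> * ?V s \<omega>) - (LINT \<omega>|M. ?V q \<omega> * ?V r \<omega>)
      - (LINT \<omega>|M. ?V p \<omega> * ?V s \<omega>) + (LINT \<omega>|M. ?V p \<omega> * ?V r \<omega>)"
    by (rule integral_diff_mult_diff) (use assms in \<open>auto intro!: L2_from_origin\<close>)
  also have "\<dots> = c\<^sup>2 * min q s - c\<^sup>2 * min q r - c\<^sup>2 * min p s + c\<^sup>2 * min p r"
    using assms by (intro arg_cong2[where f = "(+)"] arg_cong2[where f = "(-)"] covariance_from_origin_min) auto
  also have "\<dots> = c\<^sup>2 * (min q s - min q r - min p s + min p r)"
    by (simp add: algebra_simps)
  also have "min q s - min q r - min p s + min p r =
      (LINT x|unit_measure. ?\<iota> q x * ?\<iota> s x) - (LINT x|unit_measure. ?\<iota> q x * ?\<iota> r x)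
      - (LINT x|unit_measure. ?\<iota> p x * ?\<iota> s x) + (LINT x|unit_measure. ?\<iota> p x * ?\<iota> r x)"
    using assms by (intro arg_cong2[where f = "(+)"] arg_cong2[where f = "(-)"] inner_indicator_unit[symmetric]) auto
  also have "\<dots> = (LINT x|unit_measure. (?\<iota> q x - ?\<iota> p x) * (?\<iota> s x - ?\<iota> r x))"
    by (rule integral_diff_mult_diff[symmetric]) (rule indicator_L2_unit)+
  also have "\<dots> = (LINT x|unit_measure. indicator {p<..q} x * indicator {r<..s} x)"
    using assms by (intro Bochner_Integration.integral_cong) (auto simp: indicator_def)
  finally show ?thesis .
qed

lemma elementary_integral_L2:
  assumes "elementary_integral W f X"
  shows "f \<in> L2 unit_measure" "X \<in> L2 M"
proof -
  obtain m \<tau> a where *: "0 \<le> \<tau> 0" "\<And>i. i < m \<Longrightarrow> \<tau> i < \<tau> (Suc i)"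
    "f = (\<lambda>s. \<Sum>i<m. a i * indicator {\<tau> i<..\<tau> (Suc i)} s)"
    "X = (\<lambda>\<omega>. \<Sum>i<m. a i * (W (\<tau> (Suc i)) \<omega> - W (\<tau> i) \<omega>))"
    using assms unfolding elementary_integral_def by blast
  show "f \<in> L2 unit_measure"
    unfolding * by (intro L2_sum L2_cmult indicator_L2_unit)
  have "0 \<le> \<tau> i" if "i \<le> m" for i
    using partition_bounds(1)[of m \<tau> i, OF *(2) that] *(1) by simp
  then show "X \<in> L2 M"
    unfolding * using *(2) by (intro L2_sum L2_cmult increment_moments(1)) auto
qed

lemma elementary_integral_covariance:
  assumes "elementary_integral W f X" "elementary_integral W g Y"
  shows "(LINT \<omega>|M. X \<omega> * Y \<omega>) = c\<^sup>2 * (LINT x|unit_measure. f x * g x)"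
proof -
  obtain m \<tau> a where f: "0 \<le> \<tau> 0" "\<tau> m \<le> 1" "\<And>i. i < m \<Longrightarrow> \<tau> i < \<tau> (Suc i)"
    "f = (\<lambda>s. \<Sum>i<m. a i * indicator {\<tau> i<..\<tau> (Suc i)} s)"
    "X = (\<lambda>\<omega>. \<Sum>i<m. a i * (W (\<tau> (Suc i)) \<omega> - W (\<tau> i) \<omega>))"
    using assms(1) unfolding elementary_integral_def by blast
  obtain n \<sigma> b where g: "0 \<le> \<sigma> 0" "\<sigma> n \<le> 1" "\<And>i. i < n \<Longrightarrow> \<sigma> i < \<sigma> (Suc i)"
    "g = (\<lambda>s. \<Sum>i<n. b i * indicator {\<sigma> i<..\<sigma> (Suc i)} s)"
    "Y = (\<lambda>\<omega>. \<Sum>i<n. b i * (W (\<sigma> (Suc i)) \<omega> - W (\<sigma> i) \<omega>))"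
    using assms(2) unfolding elementary_integral_def by blast
  have \<tau>: "0 \<le> \<tau> i" "\<tau> i \<le> 1" if "i \<le> m" for i
    using partition_bounds[of m \<tau> i, OF f(3) that] f(1,2) by auto
  have \<sigma>: "0 \<le> \<sigma> i" "\<sigma> i \<le> 1" if "i \<le> n" for i
    using partition_bounds[of n \<sigma> i, OF g(3) that] g(1,2) by auto
  have "(LINT \<omega>|M. X \<omega> * Y \<omega>) = (\<Sum>i<m. \<Sum>j<n. a i * b j *
      (LINT \<omega>|M. (W (\<tau> (Suc i)) \<omega> - W (\<tau> i) \<omega>) * (W (\<sigma> (Suc j)) \<omega> - W (\<sigma> j) \<omega>)))"
    unfolding f(5) g(5) using \<tau> \<sigma> f(3) g(3)
    by (intro integral_sum_mult_sum increment_moments(1)) auto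
  also have "\<dots> = (\<Sum>i<m. \<Sum>j<n. a i * b j * (c\<^sup>2 *
      (LINT x|unit_measure. indicator {\<tau> i<..\<tau> (Suc i)} x * indicator {\<sigma> j<..\<sigma> (Suc j)} x)))"
  proof (intro sum.cong refl)
    fix i j assume ij: "i \<in> {..<m}" "j \<in> {..<n}"
    show "a i * b j * (LINT \<omega>|M. (W (\<tau> (Suc i)) \<omega> - W (\<tau> i) \<omega>) * (W (\<sigma> (Suc j)) \<omega> - W (\<sigma> j) \<omega>)) =
      a i * b j * (c\<^sup>2 *
      (LINT x|unit_measure. indicator {\<tau> i<..\<tau> (Suc i)} x * indicator {\<sigma> j<..\<sigma> (Suc j)} x))"
      using ij f(3)[of i] g(3)[of j] \<tau>[of i] \<tau>[of "Suc i"] \<sigma>[of j] \<sigma>[of "Suc j"]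
      by (subst increment_covariance) auto
  qed
  also have "\<dots> = c\<^sup>2 * (\<Sum>i<m. \<Sum>j<n. a i * b j *
      (LINT x|unit_measure. indicator {\<tau> i<..\<tau> (Suc i)} x * indicator {\<sigma> j<..\<sigma> (Suc j)} x))"
    unfolding sum_distrib_left by (intro sum.cong refl) (rule mult.left_commute)
  also have "(\<Sum>i<m. \<Sum>j<n. a i * b j *
      (LINT x|unit_measure. indicator {\<tau> i<..\<tau> (Suc i)} x * indicator {\<sigma> j<..\<sigma> (Suc j)} x)) =
      (LINT x|unit_measure. f x * g x)"
    unfolding f(4) g(4) by (intro integral_sum_mult_sum[symmetric] indicator_L2_unit) auto
  finally show ?thesis .
qed

text \<open>Inner products are continuous under convergence in quadratic mean, so the identity passes from
  elementary integrals to their limits on both sides.\<close>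

lemma wiener_integral_covariance:
  assumes "has_wiener_integral M W f X" "has_wiener_integral M W g Y"
  shows "(LINT \<omega>|M. X \<omega> * Y \<omega>) = c\<^sup>2 * (LINT x|unit_measure. f x * g x)"
proof -
  obtain F A where F: "\<And>n. elementary_integral W (F n) (A n)"
    "L2_tendsto unit_measure F f" "L2_tendsto M A X"
    using assms(1) unfolding has_wiener_integral_def by blast
  obtain G B where G: "\<And>n. elementary_integral W (G n) (B n)"
    "L2_tendsto unit_measure G g" "L2_tendsto M B Y"
    using assms(2) unfolding has_wiener_integral_def by blast
  have "(\<lambda>n. LINT \<omega>|M. A n \<omega> * B n \<omega>) \<longlonglongrightarrow> (LINT \<omega>|M. X \<omega> * Y \<omega>)"
    by (rule L2_tendsto_inner[OF F(3) G(3)])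
  moreover have "(\<lambda>n. LINT \<omega>|M. A n \<omega> * B n \<omega>) \<longlonglongrightarrow> c\<^sup>2 * (LINT x|unit_measure. f x * g x)"
    unfolding elementary_integral_covariance[OF F(1) G(1)]
    by (intro tendsto_mult_left L2_tendsto_inner[OF F(2) G(2)])
  ultimately show ?thesis by (rule LIMSEQ_unique)
qed

lemma elementary_integral_isometry:
  assumes "elementary_integral W f X" "elementary_integral W g Y"
  shows "(LINT \<omega>|M. (X \<omega> - Y \<omega>)\<^sup>2) = c\<^sup>2 * (LINT x|unit_measure. (f x - g x)\<^sup>2)"
proof -
  note L2 = elementary_integral_L2[OF assms(1)] elementary_integral_L2[OF assms(2)]
  show ?thesis
    unfolding integral_diff_square[OF L2(2,4)] integral_diff_square[OF L2(1,3)]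
      elementary_integral_covariance[OF assms(1,1)] elementary_integral_covariance[OF assms(1,2)]
      elementary_integral_covariance[OF assms(2,2)]
    by (simp add: distrib_left right_diff_distrib)
qed

text \<open>The isometry makes the elementary integrals of an approximating sequence a Cauchy sequence in
  \<open>L2 M\<close>.\<close>

lemma wiener_integral_exists:
  assumes f: "f \<in> L2 unit_measure"
  shows "\<exists>X. has_wiener_integral M W f X"
proof -
  have "\<exists>F Y. elementary_integral W F Y \<and> (LINT x|unit_measure. (F x - f x)\<^sup>2) < 1 / real (Suc n)" for n
  proof -
    obtain m h where "m > 0" "(LINT x|unit_measure. (grid_step m h x - f x)\<^sup>2) < 1 / real (Suc n)"
      using L2_grid_step_dense[OF f, of "1 / real (Suc n)"] by auto
    then show ?thesis using elementary_integral_grid_step[of m W h] by blast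
  qed
  then obtain F Y where FY: "\<And>n. elementary_integral W (F n) (Y n)"
    and small: "\<And>n. (LINT x|unit_measure. (F n x - f x)\<^sup>2) < 1 / real (Suc n)"
    by metis
  have F: "F n \<in> L2 unit_measure" and Y: "Y n \<in> L2 M" for n
    using elementary_integral_L2[OF FY] by auto
  have lim: "(\<lambda>n. LINT x|unit_measure. (F n x - f x)\<^sup>2) \<longlonglongrightarrow> 0"
  proof (rule Lim_null_comparison)
    show "(\<lambda>n. 1 / real (Suc n)) \<longlonglongrightarrow> 0" by (rule LIMSEQ_Suc[OF lim_1_over_n])
    show "\<forall>\<^sub>F n in sequentially. norm (LINT x|unit_measure. (F n x - f x)\<^sup>2) \<le> 1 / real (Suc n)"
      using small by (intro always_eventually allI) (simp add: less_imp_le del: of_nat_Suc)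
  qed
  have "\<exists>X. L2_tendsto M Y X"
  proof (rule L2_complete[OF Y])
    fix e :: real assume "e > 0"
    then have "e / (4 * c\<^sup>2) > 0" using c_pos by simp
    then obtain K where K: "\<And>n. n \<ge> K \<Longrightarrow> (LINT x|unit_measure. (F n x - f x)\<^sup>2) < e / (4 * c\<^sup>2)"
      using order_tendstoD(2)[OF lim] unfolding eventually_sequentially by blast
    have "(LINT \<omega>|M. (Y m \<omega> - Y n \<omega>)\<^sup>2) < e" if "m \<ge> K" "n \<ge> K" for m n
    proof -
      have comm: "(f x - F n x)\<^sup>2 = (F n x - f x)\<^sup>2" for x by (rule power2_commute)
      have "(LINT x|unit_measure. (F m x - F n x)\<^sup>2) < 4 * (e / (4 * c\<^sup>2))"
        using integral_square_triangle[OF F f F, of m n] K[OF that(1)] K[OF that(2)]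
        unfolding comm by linarith
      then have "c\<^sup>2 * (LINT x|unit_measure. (F m x - F n x)\<^sup>2) < c\<^sup>2 * (4 * (e / (4 * c\<^sup>2)))"
        using c_pos by (intro mult_strict_left_mono) auto
      then show ?thesis
        using c_pos unfolding elementary_integral_isometry[OF FY FY] by simp
    qed
    then show "\<exists>K. \<forall>m\<ge>K. \<forall>n\<ge>K. (LINT \<omega>|M. (Y m \<omega> - Y n \<omega>)\<^sup>2) < e" by blast
  qed
  then obtain X where "L2_tendsto M Y X" by blast
  moreover have "L2_tendsto unit_measure F f"
    using F f lim by (simp add: L2_tendsto_iff)
  ultimately show ?thesis
    unfolding has_wiener_integral_def using FY by blast
qed

lemma has_wiener_integral_wiener_integral:
  "f \<in> L2 unit_measure \<Longrightarrow> has_wiener_integral M W f (wiener_integral M W f)"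
  unfolding wiener_integral_def by (rule someI_ex[OF wiener_integral_exists])

text \<open>Covariances alone determine the second moment of a linear combination, so the combination itself
  need not be recognized as a Wiener integral.\<close>

lemma wiener_integral_isometry_sum:
  assumes "finite I" "\<And>k. k \<in> I \<Longrightarrow> has_wiener_integral M W (u k) (X k)"
  shows "(LINT \<omega>|M. (\<Sum>k\<in>I. a k * X k \<omega>)\<^sup>2) = c\<^sup>2 * (LINT x|unit_measure. (\<Sum>k\<in>I. a k * u k x)\<^sup>2)"
proof -
  have "(LINT \<omega>|M. (\<Sum>k\<in>I. a k * X k \<omega>)\<^sup>2) = (\<Sum>i\<in>I. \<Sum>j\<in>I. a i * a j * (LINT \<omega>|M. X i \<omega> * X j \<omega>))"
    unfolding power2_eq_square using assms has_wiener_integral_L2(2)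
    by (intro integral_sum_mult_sum) blast+
  also have "\<dots> = (\<Sum>i\<in>I. \<Sum>j\<in>I. a i * a j * (c\<^sup>2 * (LINT x|unit_measure. u i x * u j x)))"
    by (intro sum.cong refl arg_cong2[where f = "(*)"] wiener_integral_covariance assms(2))
  also have "\<dots> = c\<^sup>2 * (\<Sum>i\<in>I. \<Sum>j\<in>I. a i * a j * (LINT x|unit_measure. u i x * u j x))"
    unfolding sum_distrib_left by (intro sum.cong refl) (rule mult.left_commute)
  also have "(\<Sum>i\<in>I. \<Sum>j\<in>I. a i * a j * (LINT x|unit_measure. u i x * u j x)) =
      (LINT x|unit_measure. (\<Sum>k\<in>I. a k * u k x)\<^sup>2)"
    unfolding power2_eq_square using assms has_wiener_integral_L2(1)
    by (intro integral_sum_mult_sum[symmetric]) blast+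
  finally show ?thesis .
qed

lemma wiener_integral_distance:
  fixes n :: nat
  assumes u: "\<And>k. has_wiener_integral M W (u k) (X k)" and v: "has_wiener_integral M W v Y"
  shows "(LINT \<omega>|M. ((\<Sum>k<n. a k * X k \<omega>) - Y \<omega>)\<^sup>2) =
    c\<^sup>2 * (LINT x|unit_measure. ((\<Sum>k<n. a k * u k x) - v x)\<^sup>2)"
proof -
  \<comment> \<open>The subtracted integral enters as one more term, with coefficient \<open>- 1\<close> and index \<open>n\<close>.\<close>
  have eq: "(\<Sum>k\<in>{..n}. (a(n := - 1)) k * (z(n := y)) k x) = (\<Sum>k<n. a k * z k x) - y x"
    for z and y :: "'z \<Rightarrow> real" and x
    by (simp add: lessThan_Suc_atMost[symmetric])
  have "has_wiener_integral M W ((u(n := v)) k) ((X(n := Y)) k)" for k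
    using u v by simp
  then show ?thesis
    using wiener_integral_isometry_sum[of "{..n}" "u(n := v)" "X(n := Y)" "a(n := - 1)"]
    unfolding eq by simp
qed

end

section \<open>Expansion of the stochastic integral\<close>

theorem theorem2:
  fixes M :: "'a measure" and W :: "real \<Rightarrow> 'a \<Rightarrow> real" and c \<alpha> :: real
    and g :: "real \<Rightarrow> real" and b :: "nat \<Rightarrow> real" and B :: "nat \<Rightarrow> 'a \<Rightarrow> real" and t :: real
  assumes "\<alpha> > 0"
    and "wiener_process M c W"
    and "g \<in> L2 weighted_measure"
    and "\<And>n. b n = (LINT x|unit_measure. thermite_fun \<alpha> n x * g x * weight x)"
    and "\<And>n. B n = wiener_integral M W (\<lambda>s. thermite_fun \<alpha> n s * sqrt (weight s))"
    and "t \<in> {0<..<1}"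
  shows "(\<exists>G. L2_sums weighted_measure (\<lambda>k s. b k * thermite_fun \<alpha> k s * thermite_fun \<alpha> k t) G) \<and>
    (\<forall>G. L2_sums weighted_measure (\<lambda>k s. b k * thermite_fun \<alpha> k s * thermite_fun \<alpha> k t) G \<longrightarrow>
       L2_sums M (\<lambda>n \<omega>. b n * B n \<omega> * thermite_fun \<alpha> n t)
         (wiener_integral M W (\<lambda>s. G s * sqrt (weight s))))"
proof (intro conjI allI impI)
  interpret wiener_process M c W by (rule assms(2))
  define a where "a k = b k * thermite_fun \<alpha> k t" for k
  define u where "u k s = thermite_fun \<alpha> k s * sqrt (weight s)" for k s
  have \<psi>: "thermite_fun \<alpha> k \<in> L2 weighted_measure" for k
    by (rule thermite_fun_L2[OF assms(1)])
  have b: "b k = (LINT x|weighted_measure. thermite_fun \<alpha> k x * g x)" for k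
    unfolding assms(4)
    using \<psi> assms(3) by (intro integral_weighted(2)[symmetric] borel_measurable_times)
      (simp_all add: L2_iff measurable_weighted_iff)
  have terms: "(\<lambda>k s. b k * thermite_fun \<alpha> k s * thermite_fun \<alpha> k t) = (\<lambda>k s. a k * thermite_fun \<alpha> k s)"
    by (simp add: a_def mult_ac)
  have "summable (\<lambda>k. (a k)\<^sup>2)"
    unfolding a_def b by (rule summable_coefficients_thermite[OF assms(1,3)])
  then show "\<exists>G. L2_sums weighted_measure (\<lambda>k s. b k * thermite_fun \<alpha> k s * thermite_fun \<alpha> k t) G"
    unfolding terms using thermite_orthonormal[OF assms(1)]
    by (intro orthonormal_series_converges \<psi>) (simp_all add: has_bochner_integral_iff)

  fix G
  assume "L2_sums weighted_measure (\<lambda>k s. b k * thermite_fun \<alpha> k s * thermite_fun \<alpha> k t) G"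
  then have G: "G \<in> L2 weighted_measure"
    and lim: "(\<lambda>n. LINT s|weighted_measure. ((\<Sum>k<n. a k * thermite_fun \<alpha> k s) - G s)\<^sup>2) \<longlonglongrightarrow> 0"
    unfolding terms by (simp_all add: L2_sums_def L2_tendsto_iff)
  let ?I = "wiener_integral M W (\<lambda>s. G s * sqrt (weight s))"
  have I: "has_wiener_integral M W (\<lambda>s. G s * sqrt (weight s)) ?I"
    by (intro has_wiener_integral_wiener_integral L2_weighted_times_sqrt G)
  have B: "has_wiener_integral M W (u k) (B k)" for k
    unfolding assms(5) u_def[abs_def] by (intro has_wiener_integral_wiener_integral L2_weighted_times_sqrt \<psi>)
  have "(LINT \<omega>|M. ((\<Sum>k<n. a k * B k \<omega>) - ?I \<omega>)\<^sup>2) =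
      c\<^sup>2 * (LINT s|weighted_measure. ((\<Sum>k<n. a k * thermite_fun \<alpha> k s) - G s)\<^sup>2)" for n
  proof -
    have "(\<lambda>s. (\<Sum>k<n. a k * thermite_fun \<alpha> k s) - G s) \<in> L2 weighted_measure"
      by (intro L2_diff L2_sum L2_cmult \<psi> G)
    then have "(\<lambda>s. ((\<Sum>k<n. a k * thermite_fun \<alpha> k s) - G s)\<^sup>2) \<in> borel_measurable unit_measure"
      by (intro borel_measurable_power) (simp add: L2_iff measurable_weighted_iff)
    then have "(LINT s|weighted_measure. ((\<Sum>k<n. a k * thermite_fun \<alpha> k s) - G s)\<^sup>2) =
        (LINT s|unit_measure. ((\<Sum>k<n. a k * thermite_fun \<alpha> k s) - G s)\<^sup>2 * weight s)"
      by (rule integral_weighted(2))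
    also have "\<dots> = (LINT s|unit_measure. ((\<Sum>k<n. a k * u k s) - G s * sqrt (weight s))\<^sup>2)"
    proof (rule Bochner_Integration.integral_cong[OF refl])
      fix s assume "s \<in> space unit_measure"
      then have w: "weight s \<ge> 0" by (simp add: space_restrict_space weight_nonneg)
      have "(\<Sum>k<n. a k * u k s) - G s * sqrt (weight s) =
          ((\<Sum>k<n. a k * thermite_fun \<alpha> k s) - G s) * sqrt (weight s)"
        by (simp add: u_def left_diff_distrib sum_distrib_right mult.assoc)
      then show "((\<Sum>k<n. a k * thermite_fun \<alpha> k s) - G s)\<^sup>2 * weight s =
          ((\<Sum>k<n. a k * u k s) - G s * sqrt (weight s))\<^sup>2"
        using w by (simp add: power_mult_distrib)
    qed
    finally show ?thesis
      using wiener_integral_distance[OF B I, where a = a and n = n] by simp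
  qed
  then have "(\<lambda>n. LINT \<omega>|M. ((\<Sum>k<n. a k * B k \<omega>) - ?I \<omega>)\<^sup>2) \<longlonglongrightarrow> 0"
    using tendsto_mult_left[OF lim, of "c\<^sup>2"] by simp
  moreover have "(\<lambda>\<omega>. \<Sum>k<n. a k * B k \<omega>) \<in> L2 M" for n
    by (intro L2_sum L2_cmult has_wiener_integral_L2(2)[OF B])
  moreover have "(\<lambda>n \<omega>. b n * B n \<omega> * thermite_fun \<alpha> n t) = (\<lambda>n \<omega>. a n * B n \<omega>)"
    by (simp add: a_def mult_ac)
  ultimately show "L2_sums M (\<lambda>n \<omega>. b n * B n \<omega> * thermite_fun \<alpha> n t) ?I"
    using has_wiener_integral_L2(2)[OF I] by (simp add: L2_sums_def L2_tendsto_iff)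
qed

end
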